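(* For every convex $n$-gon $D_n$ ($n\ge 3$) there is at least one proportional system of triangles $\{T_k\}_{k=1}^n$ (in particular, admissible for $D_n$) that covers $D_n$, i.e. $$\bigcup_{k=1}^n\overline{T}_k\supset D_n .$$
   Context: An $n$-gon ($n\ge3$) is a simply connected Jordan domain in $\mathbb{C}$ whose boundary consists of $n$ rectilinear segments, called its sides. Let $D_n$ be a convex $n$-gon with vertices $A_1,\ldots,A_n,A_{n+1}=A_1$ enumerated in the positive direction on $\partial D_n$. A system of Euclidean triangles $\{T_k\}_{k=1}^n$ is called admissible for $D_n$ if $T_k\cap D_n\neq\emptyset$, $T_k$ has the segment $[A_k,A_{k+1}]$ as its base, and for all $k=1,\ldots,n$ (with $T_{n+1}=T_1$) the triangles $T_k$ and $T_{k+1}$ have a common boundary segment which is an entire side of at least one of these triangles, but not necessarily of both of them. Let $\alpha_k$ denote the angle of $T_k$ opposite the base $[A_k,A_{k+1}]$. An admissible system $\{T_k\}_{k=1}^n$ is called proportional if the quotient $\alpha_k/\operatorname{Area}T_k$ does not depend on $k=1,\ldots,n$. *)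

theory Defs
  imports "HOL-Analysis.Analysis"
begin

section \<open>Polygons\<close>

text \<open>
  The vertices of an n-gon are \<open>A 0, \<dots>, A (n - 1)\<close>, with indices taken modulo \<open>n\<close>. The closed
  polygonal path through them runs along the \<open>k\<close>-th side, from \<open>A k\<close> to \<open>A (Suc k mod n)\<close>, as the
  parameter runs over \<open>[k / n, (k + 1) / n]\<close>.
\<close>

definition closed_polygonal_path :: "nat \<Rightarrow> (nat \<Rightarrow> complex) \<Rightarrow> real \<Rightarrow> complex" where
  "closed_polygonal_path n A t =
     (let k = nat \<lfloor>real n * t\<rfloor>
      in linepath (A (k mod n)) (A (Suc k mod n)) (frac (real n * t)))"

text \<open>
  The Jordan domain bounded by a simple closed polygonal path. The last condition says that every
  \<open>A j\<close> is a genuine corner, so that \<open>n\<close> is the number of sides.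
\<close>

definition is_ngon :: "nat \<Rightarrow> (nat \<Rightarrow> complex) \<Rightarrow> complex set \<Rightarrow> bool" where
  "is_ngon n A D \<longleftrightarrow>
     n \<ge> 3 \<and>
     simple_path (closed_polygonal_path n A) \<and>
     D = inside (path_image (closed_polygonal_path n A)) \<and>
     (\<forall>k<n. \<not> collinear {A k, A (Suc k mod n), A (Suc (Suc k) mod n)})"

text \<open>
  For a convex domain, traversing the boundary in the positive (counterclockwise) direction means
  that the whole domain lies to the left of each directed side:
  \<open>Im (cnj u * v) > 0\<close> says that \<open>v\<close> points to the left of \<open>u\<close>.
\<close>

definition positively_enumerated :: "nat \<Rightarrow> (nat \<Rightarrow> complex) \<Rightarrow> complex set \<Rightarrow> bool" where
  "positively_enumerated n A D \<longleftrightarrow>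
     (\<forall>k<n. \<forall>z\<in>D. Im (cnj (A (Suc k mod n) - A k) * (z - A k)) > 0)"

definition is_convex_ngon :: "nat \<Rightarrow> (nat \<Rightarrow> complex) \<Rightarrow> complex set \<Rightarrow> bool" where
  "is_convex_ngon n A D \<longleftrightarrow> is_ngon n A D \<and> convex D \<and> positively_enumerated n A D"

section \<open>Systems of triangles\<close>

text \<open>
  A triangle with base \<open>[A k, A (Suc k mod n)]\<close> is determined by its apex \<open>P k\<close>, so a system of
  triangles based on the sides is given by the function \<open>P\<close>. Triangles are open sets.
\<close>

definition base_triangle :: "nat \<Rightarrow> (nat \<Rightarrow> complex) \<Rightarrow> (nat \<Rightarrow> complex) \<Rightarrow> nat \<Rightarrow> complex set" where
  "base_triangle n A P k = interior (convex hull {A k, A (Suc k mod n), P k})"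

definition triangle_sides ::
    "nat \<Rightarrow> (nat \<Rightarrow> complex) \<Rightarrow> (nat \<Rightarrow> complex) \<Rightarrow> nat \<Rightarrow> complex set set" where
  "triangle_sides n A P k =
     {closed_segment (A k) (A (Suc k mod n)),
      closed_segment (A (Suc k mod n)) (P k),
      closed_segment (P k) (A k)}"

definition angle_at :: "complex \<Rightarrow> complex \<Rightarrow> complex \<Rightarrow> real" where
  "angle_at p a b = arccos ((a - p) \<bullet> (b - p) / (norm (a - p) * norm (b - p)))"

definition apex_angle :: "nat \<Rightarrow> (nat \<Rightarrow> complex) \<Rightarrow> (nat \<Rightarrow> complex) \<Rightarrow> nat \<Rightarrow> real" where
  "apex_angle n A P k = angle_at (P k) (A k) (A (Suc k mod n))"

text \<open>
  Consecutive triangles adjoin along a common boundary segment that is an entire side of one of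
  them. Requiring this side to be the whole intersection of the two closed triangles
  places the segment on both boundaries and excludes overlapping triangles, which could
  share a segment while lying on the same side of it.
\<close>

definition admissible_system ::
    "nat \<Rightarrow> (nat \<Rightarrow> complex) \<Rightarrow> complex set \<Rightarrow> (nat \<Rightarrow> complex) \<Rightarrow> bool" where
  "admissible_system n A D P \<longleftrightarrow>
     (\<forall>k<n. \<not> collinear {A k, A (Suc k mod n), P k} \<and>
            base_triangle n A P k \<inter> D \<noteq> {} \<and>
            (\<exists>S \<in> triangle_sides n A P k \<union> triangle_sides n A P (Suc k mod n).
               closure (base_triangle n A P k) \<inter> closure (base_triangle n A P (Suc k mod n)) = S))"

definition proportional_system ::
    "nat \<Rightarrow> (nat \<Rightarrow> complex) \<Rightarrow> complex set \<Rightarrow> (nat \<Rightarrow> complex) \<Rightarrow> bool" where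
  "proportional_system n A D P \<longleftrightarrow>
     admissible_system n A D P \<and>
     (\<exists>c. \<forall>k<n. apex_angle n A P k / measure lebesgue (base_triangle n A P k) = c)"

end

theory Submission
  imports Defs
begin

text \<open>
  Send a ray from every vertex \<open>A k\<close> into the polygon, in the direction with angle \<open>\<psi> k\<close>, and let the
  \<open>k\<close>-th triangle be cut off from the \<open>k\<close>-th side by the rays at its two end points. Consecutive
  triangles then lie on different sides of a common ray and adjoin along the shorter of two
  segments of it, so such a system is admissible. If the \<open>k\<close>-th side has direction \<open>\<tau> k\<close> and
  length \<open>l k\<close>, the rays have to satisfy only \<open>\<tau> k < \<psi> k < \<psi> (k + 1) < \<tau> k + \<pi>\<close>; the angle at the
  apex is \<open>\<psi> (k + 1) - \<psi> k\<close>, and the area is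
  \<open>(l k)\<^sup>2 / 2 * sin (\<psi> k - \<tau> k) * sin (\<psi> (k + 1) - \<tau> k) / sin (\<psi> (k + 1) - \<psi> k)\<close>.

  For a given ratio \<open>c\<close>, the equation angle = \<open>c\<close> * area determines \<open>\<psi> (k + 1)\<close> from \<open>\<psi> k\<close>, and the
  solution increases strictly with \<open>\<psi> k\<close> and with \<open>c\<close>. Hence for every first direction \<open>\<psi> 0\<close> in a
  certain open interval there is exactly one \<open>c\<close> for which the rays close up after one round
  (\<open>closing_ratio\<close>), and it depends continuously on \<open>\<psi> 0\<close>. The proportional systems of this kind thus
  form a continuous family over an interval.

  A point of the polygon that is not covered by a member of the family lies to the left of all rays
  or to the right of all rays (\<open>uncovered_one_sided\<close>): a point to the right of one ray and to the
  left of the next lies in the triangle between them, and going around the polygon the sides on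
  which a point lies must change in this way unless they never change. Having an uncovered
  point of the left kind is an open condition on \<open>\<psi> 0\<close>, and so is having one of the right kind; the
  two conditions exclude each other (\<open>not_left_and_right\<close>), because the directions of the rays are
  not contained in a half plane. At both ends of the interval \<open>c\<close> tends to infinity. The triangles
  become flat and leave a fixed inner point uncovered, which is on the left of the
  rays at the lower end and on their right at the upper end (\<open>one_sided_exists\<close>). Since
  an interval is connected, some member of the family has no uncovered point.
\<close>

section \<open>Consecutive rays\<close>

text \<open>
  For a base of direction \<open>t\<close> and length \<open>l\<close>, cut off by rays of directions \<open>x\<close> and \<open>y\<close>, the value at
  \<open>K = c * l\<^sup>2 / 2\<close> is the difference between apex angle and \<open>c\<close> * area, multiplied by the positive factor
  \<open>sin (y - x)\<close>. Without the denominator \<open>sin (y - x)\<close> of the area it is defined and continuous everywhere.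
\<close>
definition defect :: "real \<Rightarrow> real \<Rightarrow> real \<Rightarrow> real \<Rightarrow> real" where
  "defect t K x y = (y - x) * sin (y - x) - K * sin (x - t) * sin (y - t)"

text \<open>
  The value \<open>x\<close> for \<open>x \<le> t\<close>, where a ray has left the polygon and there is no triangle, is the
  continuous extension: as \<open>x\<close> decreases to \<open>t\<close>, so does the solution \<open>y\<close>. It makes chains of rays
  total and continuous functions of the first ray, and a chain that has left the polygon stays outside.
\<close>
definition next_dir :: "real \<Rightarrow> real \<Rightarrow> real \<Rightarrow> real" where
  "next_dir t K x = (if x \<le> t then x else (THE y. x < y \<and> y < t + pi \<and> defect t K x y = 0))"

text \<open>The Pluecker relation between four unit vectors in the plane; the monotonicity of the
  quotients of sines below rests on it.\<close>
lemma sin_four_term: "sin (a - c) * sin (b - d) - sin (a - b) * sin (c - d) = sin (a - d) * sin (b - c)"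
  for a b c d :: real
  unfolding sin_diff by (simp add: algebra_simps)

text \<open>
  Divided by \<open>sin (x - t) * sin (y - t)\<close>, the defect is \<open>(y - x) * (cot (x - t) - cot (y - t)) - K\<close>, which
  increases with \<open>y\<close> and, by the next lemma, decreases with \<open>x\<close>. Hence the defect changes
  its sign at most once.
\<close>
lemma defect_pos_right:
  assumes "t < x" "x < y" "y < y'" "y' < t + pi" "defect t K x y \<ge> 0"
  shows "defect t K x y' > 0"
proof -
  have s: "sin (y - t) > 0" "sin (y' - t) > 0" "sin (x - t) > 0" "sin (y' - y) > 0" "sin (y - x) > 0"
    using assms by (auto intro!: sin_gt_zero)
  have plucker: "sin (y' - x) * sin (y - t) = sin (y - x) * sin (y' - t) + sin (x - t) * sin (y' - y)"
    using sin_four_term[of y' x y t] by (simp add: algebra_simps)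
  have "K * sin (x - t) * sin (y - t) * sin (y' - t) \<le> (y - x) * sin (y - x) * sin (y' - t)"
    using assms s by (intro mult_right_mono) (auto simp: defect_def)
  also have "\<dots> < (y' - x) * sin (y - x) * sin (y' - t)"
    using assms s by simp
  also have "\<dots> < (y' - x) * (sin (y - x) * sin (y' - t) + sin (x - t) * sin (y' - y))"
    using assms s by (simp add: distrib_left)
  also have "\<dots> = (y' - x) * sin (y' - x) * sin (y - t)"
    using plucker by simp
  finally have "0 < sin (y - t) * defect t K x y'"
    by (simp add: defect_def algebra_simps)
  then show ?thesis
    using s by (simp add: zero_less_mult_iff)
qed

lemma defect_neg_left:
  assumes "t < x" "x < x'" "x' < y" "y < t + pi" "defect t K x y = 0"
  shows "defect t K x' y < 0"
proof -
  have s: "sin (y - t) > 0" "sin (x' - t) > 0" "sin (x - t) > 0" "sin (x' - x) > 0" "sin (y - x) > 0" "sin (y - x') > 0"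
    using assms by (auto intro!: sin_gt_zero)
  have plucker: "sin (y - x) * sin (x' - t) = sin (y - x') * sin (x - t) + sin (y - t) * sin (x' - x)"
    using sin_four_term[of y x x' t] by (simp add: algebra_simps)
  have "(y - x') * sin (y - x') * sin (x - t) < (y - x) * sin (y - x') * sin (x - t)"
    using assms s by simp
  also have "\<dots> < (y - x) * (sin (y - x') * sin (x - t) + sin (y - t) * sin (x' - x))"
    using assms s by (simp add: distrib_left)
  also have "\<dots> = (y - x) * sin (y - x) * sin (x' - t)"
    using plucker by simp
  also have "\<dots> = K * sin (x - t) * sin (y - t) * sin (x' - t)"
    using assms by (simp add: defect_def)
  finally have "0 > sin (x - t) * defect t K x' y"
    by (simp add: defect_def algebra_simps)
  then show ?thesis
    using s by (simp add: mult_less_0_iff)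
qed

lemma defect_root_exists:
  assumes "t < x" "x < t + pi" "K > 0"
  shows "\<exists>y. x < y \<and> y < t + pi \<and> defect t K x y = 0"
proof -
  have s: "sin (x - t) > 0" "sin (t + pi - x) > 0"
    using assms by (auto intro!: sin_gt_zero)
  have 0: "defect t K x x < 0" "defect t K x (t + pi) > 0"
    using assms s by (auto simp: defect_def)
  have "continuous_on {x..t + pi} (defect t K x)"
    unfolding defect_def by (intro continuous_intros)
  then obtain y where "x \<le> y" "y \<le> t + pi" "defect t K x y = 0"
    using IVT'[of "defect t K x" x 0 "t + pi"] 0 assms by auto
  moreover have "x \<noteq> y" "y \<noteq> t + pi"
    using \<open>defect t K x y = 0\<close> 0 by auto
  ultimately show ?thesis
    by (metis less_eq_real_def)
qed

lemma defect_root_unique: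
  assumes "t < x" "x < y" "y < t + pi" "defect t K x y = 0"
    and "x < y'" "y' < t + pi" "defect t K x y' = 0"
  shows "y = y'"
  using defect_pos_right[of t x y y' K] defect_pos_right[of t x y' y K] assms
  by (cases y y' rule: linorder_cases) auto

lemma next_dir_eqI:
  assumes "t < x" "x < y" "y < t + pi" "defect t K x y = 0"
  shows "next_dir t K x = y"
proof -
  have "(THE z. x < z \<and> z < t + pi \<and> defect t K x z = 0) = y"
    using assms by (intro the_equality) (auto dest: defect_root_unique[OF assms])
  then show ?thesis
    using assms by (simp add: next_dir_def)
qed

lemma next_dir_root:
  assumes "t < x" "x < t + pi" "K > 0"
  shows "x < next_dir t K x" "next_dir t K x < t + pi" "defect t K x (next_dir t K x) = 0"
  using defect_root_exists[OF assms] next_dir_eqI[OF assms(1)] by auto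

lemma next_dir_le: "x \<le> t \<Longrightarrow> next_dir t K x = x"
  by (simp add: next_dir_def)

lemma next_dir_bounds:
  assumes "x < t + pi" "K > 0"
  shows "x \<le> next_dir t K x" "next_dir t K x < t + pi"
  using assms next_dir_root[of t x K] next_dir_le[of x t K]
  by (cases "x \<le> t"; force)+

lemma next_dir_less_iff:
  assumes "t < x" "x < y" "y < t + pi" "K > 0"
  shows "next_dir t K x < y \<longleftrightarrow> defect t K x y > 0"
  using defect_pos_right[of t x "next_dir t K x" y K] defect_pos_right[of t x y "next_dir t K x" K]
    next_dir_root[of t x K] assms
  by (cases "next_dir t K x" y rule: linorder_cases) auto

lemma less_next_dir_iff:
  assumes "t < x" "x < y" "y < t + pi" "K > 0"
  shows "y < next_dir t K x \<longleftrightarrow> defect t K x y < 0"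
  using defect_pos_right[of t x "next_dir t K x" y K] defect_pos_right[of t x y "next_dir t K x" K]
    next_dir_root[of t x K] assms
  by (cases "next_dir t K x" y rule: linorder_cases) (auto simp: not_le[symmetric])

lemma next_dir_strict_mono_factor:
  assumes "t < x" "x < t + pi" "0 < K" "K < K'"
  shows "next_dir t K x < next_dir t K' x"
proof -
  define y where "y = next_dir t K x"
  have y: "x < y" "y < t + pi" "defect t K x y = 0"
    using next_dir_root[of t x K] assms by (auto simp: y_def)
  have "0 < sin (x - t) * sin (y - t)"
    using assms y by (intro mult_pos_pos sin_gt_zero) auto
  then have "K * (sin (x - t) * sin (y - t)) < K' * (sin (x - t) * sin (y - t))"
    using assms by (intro mult_strict_right_mono)
  then have "defect t K' x y < 0"
    using y(3) by (simp add: defect_def algebra_simps)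
  then show ?thesis
    using less_next_dir_iff[of t x y K'] assms y by (simp add: y_def)
qed

lemma next_dir_mono_factor:
  assumes "x < t + pi" "0 < K" "K \<le> K'"
  shows "next_dir t K x \<le> next_dir t K' x"
  using next_dir_strict_mono_factor[of t x K K'] next_dir_le[of x t] assms
  by (cases "x \<le> t"; cases "K = K'") auto

lemma next_dir_strict_mono:
  assumes "x < x'" "x' < t + pi" "0 < K"
  shows "next_dir t K x < next_dir t K x'"
proof (cases "x \<le> t")
  case True
  then show ?thesis
    using assms next_dir_bounds(1)[of x' t K] by (simp add: next_dir_le)
next
  case False
  define y where "y = next_dir t K x"
  have y: "x < y" "y < t + pi" "defect t K x y = 0"
    using next_dir_root[of t x K] assms False by (auto simp: y_def)
  show ?thesis
  proof (cases "y \<le> x'")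
    case True
    then show ?thesis
      using next_dir_root(1)[of t x' K] assms False by (simp add: y_def)
  next
    case F: False
    then have "defect t K x' y < 0"
      using defect_neg_left[of t x x' y K] assms y False by auto
    then show ?thesis
      using less_next_dir_iff[of t x' y K] assms y False F by (simp add: y_def)
  qed
qed

lemma next_dir_mono:
  assumes "x \<le> x'" "x' < t + pi" "0 < K"
  shows "next_dir t K x \<le> next_dir t K x'"
  using next_dir_strict_mono[of x x' t K] assms by (cases "x = x'") auto

text \<open>
  The defect at a fixed test point \<open>z\<close> is continuous, and its sign tells on which side of \<open>z\<close> the
  solution lies. This carries over to \<open>x = t\<close> from above, where the defect at every \<open>z > t\<close> is positive.
\<close>
lemma tendsto_next_dir:
  assumes g: "(g \<longlongrightarrow> x) F" and k: "(k \<longlongrightarrow> K) F" and K: "K > 0" and x: "x < t + pi"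
  shows "((\<lambda>a. next_dir t (k a) (g a)) \<longlongrightarrow> next_dir t K x) F"
proof (rule order_tendstoI)
  have kpos: "\<forall>\<^sub>F a in F. k a > 0" and gpi: "\<forall>\<^sub>F a in F. g a < t + pi"
    using order_tendstoD[OF g] order_tendstoD[OF k] K x by auto
  have lim: "((\<lambda>a. defect t (k a) (g a) y) \<longlongrightarrow> defect t K x y) F" for y
    unfolding defect_def
    by (intro tendsto_diff tendsto_mult tendsto_const g k isCont_tendsto_compose[OF isCont_sin])
  show "\<forall>\<^sub>F a in F. y < next_dir t (k a) (g a)" if y: "y < next_dir t K x" for y
  proof (cases "y < x")
    case True
    then have "\<forall>\<^sub>F a in F. y < g a"
      using order_tendstoD[OF g] by auto
    then show ?thesis
      using kpos gpi by eventually_elim (use next_dir_bounds in force)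
  next
    case False
    then have xt: "x > t"
      using y next_dir_le[of x t K] by force
    obtain z where z: "y < z" "z < next_dir t K x"
      using y dense by blast
    have zb: "x < z" "z < t + pi"
      using z False next_dir_bounds[of x t K] x K by auto
    have "defect t K x z < 0"
      using less_next_dir_iff[of t x z K] zb z xt K by simp
    then have "\<forall>\<^sub>F a in F. defect t (k a) (g a) z < 0"
      using order_tendstoD[OF lim] by auto
    moreover have "\<forall>\<^sub>F a in F. t < g a" "\<forall>\<^sub>F a in F. g a < z"
      using order_tendstoD[OF g] xt zb by auto
    ultimately show ?thesis
      using kpos
    proof eventually_elim
      case (elim a)
      then have "z < next_dir t (k a) (g a)"
        using less_next_dir_iff[of t "g a" z "k a"] zb by simp
      then show ?case
        using z by simp
    qed
  qed
  show "\<forall>\<^sub>F a in F. next_dir t (k a) (g a) < y" if y: "next_dir t K x < y" for y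
  proof (cases "x < t")
    case True
    then have "\<forall>\<^sub>F a in F. g a < t" "\<forall>\<^sub>F a in F. g a < y"
      using order_tendstoD[OF g] y next_dir_le[of x t K] by auto
    then show ?thesis
      by eventually_elim (simp add: next_dir_le)
  next
    case False
    obtain z where z: "next_dir t K x < z" "z < min y (t + pi)"
      using y dense[of "next_dir t K x" "min y (t + pi)"] next_dir_bounds[of x t K] x K by auto
    have zb: "x < z" "z < t + pi"
      using z False next_dir_bounds[of x t K] x K by auto
    have "defect t K x z > 0"
    proof (cases "x = t")
      case True
      then show ?thesis
        using zb by (auto simp: defect_def intro!: mult_pos_pos sin_gt_zero)
    next
      case F: False
      then show ?thesis
        using next_dir_less_iff[of t x z K] zb z False K by simp
    qed
    then have "\<forall>\<^sub>F a in F. defect t (k a) (g a) z > 0"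
      using order_tendstoD[OF lim] by auto
    moreover have "\<forall>\<^sub>F a in F. g a < z"
      using order_tendstoD[OF g] zb by auto
    ultimately show ?thesis
      using kpos
    proof eventually_elim
      case (elim a)
      then have "next_dir t (k a) (g a) < z"
        using next_dir_less_iff[of t "g a" z "k a"] next_dir_le[of "g a" t] zb
        by (cases "g a \<le> t") auto
      then show ?case
        using z by simp
    qed
  qed
qed

text \<open>For a small ratio the rays hardly turn, uniformly in \<open>x\<close>, since both sines are at most 1.\<close>
lemma next_dir_increment_less:
  assumes "x < t + pi" "0 < d" "d < pi" "0 < K" "K < d * sin d"
  shows "next_dir t K x < x + d"
proof (cases "x \<le> t \<or> t + pi \<le> x + d")
  case True
  then show ?thesis
    using next_dir_le[of x t K] next_dir_bounds[of x t K] assms by auto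
next
  case False
  have "sin (x - t) > 0" "sin (x + d - t) > 0"
    using False assms by (auto intro!: sin_gt_zero)
  then have "K * (sin (x - t) * sin (x + d - t)) \<le> K"
    using assms mult_left_mono[of "sin (x - t) * sin (x + d - t)" 1 K]
    by (simp add: mult_le_one)
  also have "K < d * sin d"
    by fact
  finally have "defect t K x (x + d) > 0"
    by (simp add: defect_def mult.assoc)
  then show ?thesis
    using next_dir_less_iff[of t x "x + d" K] False assms by auto
qed

lemma eventually_less_next_dir:
  assumes "t < x" "x < t + pi" "y < t + pi" "w > 0"
  shows "\<forall>\<^sub>F c in at_top. y < next_dir t (c * w) x"
proof (cases "y \<le> x")
  case True
  have "\<forall>\<^sub>F c::real in at_top. 0 < c"
    by (rule eventually_gt_at_top)
  then show ?thesis
    by eventually_elim (use True assms in \<open>auto intro!: le_less_trans[OF _ next_dir_root(1)]\<close>)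
next
  case False
  define s where "s = w * (sin (x - t) * sin (y - t))"
  have s: "s > 0"
    unfolding s_def using assms False by (intro mult_pos_pos sin_gt_zero) auto
  have "\<forall>\<^sub>F c::real in at_top. 0 < c"
    by (rule eventually_gt_at_top)
  moreover have "\<forall>\<^sub>F c in at_top. (y - x) * sin (y - x) / s < c"
    by (rule eventually_gt_at_top)
  ultimately show ?thesis
  proof eventually_elim
    case (elim c)
    then have "(y - x) * sin (y - x) < c * s"
      using s by (simp add: divide_less_eq)
    then have "defect t (c * w) x y < 0"
      by (simp add: defect_def s_def mult_ac)
    then show ?case
      using less_next_dir_iff[of t x y "c * w"] assms False elim by simp
  qed
qed

section \<open>Chains of rays that close up\<close>

text \<open>
  The directions \<open>\<tau> k\<close> of the sides of a closed polygon that turns left at each vertex, as continuously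
  lifted angles: \<open>\<tau> n\<close> belongs to side 0 again, after at least one full turn. The weight \<open>w k\<close> stands for
  half the squared length of the side.
\<close>
locale side_directions =
  fixes n :: nat and \<tau> w :: "nat \<Rightarrow> real"
  assumes three_le: "3 \<le> n"
    and turn_pos: "k < n \<Longrightarrow> \<tau> k < \<tau> (Suc k)"
    and turn_less: "k < n \<Longrightarrow> \<tau> (Suc k) < \<tau> k + pi"
    and weight_pos: "k < n \<Longrightarrow> 0 < w k"
    and full_turn: "\<tau> 0 + 2 * pi \<le> \<tau> n"
begin

fun chain :: "real \<Rightarrow> real \<Rightarrow> nat \<Rightarrow> real" where
  "chain c x 0 = x"
| "chain c x (Suc k) = next_dir (\<tau> k) (c * w k) (chain c x k)"

lemma chain_less:
  assumes "x < \<tau> 0 + pi" "0 < c" "k \<le> n"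
  shows "chain c x k < \<tau> k + pi"
  using assms(3)
proof (induction k)
  case (Suc k)
  then have "chain c x (Suc k) < \<tau> k + pi"
    using next_dir_bounds(2)[of "chain c x k" "\<tau> k" "c * w k"] weight_pos[of k] assms by simp
  then show ?case
    using turn_pos[of k] Suc by simp
qed (use assms in simp)

lemma tendsto_chain:
  assumes "(g \<longlongrightarrow> x) F" "(h \<longlongrightarrow> c) F" "x < \<tau> 0 + pi" "0 < c" "k \<le> n"
  shows "((\<lambda>a. chain (h a) (g a) k) \<longlongrightarrow> chain c x k) F"
  using assms(5)
proof (induction k)
  case (Suc k)
  then have "((\<lambda>a. next_dir (\<tau> k) (h a * w k) (chain (h a) (g a) k))
      \<longlongrightarrow> next_dir (\<tau> k) (c * w k) (chain c x k)) F"
    using weight_pos[of k] chain_less[of x c k] assms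
    by (intro tendsto_next_dir tendsto_mult_right) auto
  then show ?case by simp
qed (use assms in simp)

lemma chain_strict_mono:
  assumes "\<tau> 0 < x" "x < \<tau> 0 + pi" "0 < c" "c < c'" "k < n"
  shows "chain c x (Suc k) < chain c' x (Suc k)"
  using assms(5)
proof (induction k)
  case 0
  then show ?case
    using next_dir_strict_mono_factor[of "\<tau> 0" x "c * w 0" "c' * w 0"] weight_pos[of 0] assms by simp
next
  case (Suc k)
  let ?m = "Suc k"
  have w: "0 < w ?m"
    using weight_pos Suc by simp
  have "chain c x (Suc ?m) < next_dir (\<tau> ?m) (c * w ?m) (chain c' x ?m)"
    using Suc w assms chain_less[of x c' ?m]
    by (simp only: chain.simps(2)[of _ _ ?m]) (intro next_dir_strict_mono; simp)
  also have "\<dots> \<le> chain c' x (Suc ?m)"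
    using Suc.prems w assms chain_less[of x c' ?m]
    by (simp only: chain.simps(2)[of _ _ ?m]) (intro next_dir_mono_factor; simp)
  finally show ?case .
qed

text \<open>
  A ray that does not point to the left of its side keeps its direction from then on, while the sides
  turn further left. So a chain that closes up never gets stuck.
\<close>
lemma chain_stuck:
  assumes "chain c x k \<le> \<tau> k" "k \<le> j" "j \<le> n"
  shows "chain c x j \<le> \<tau> j"
  using assms(2,3)
proof (induction j rule: dec_induct)
  case (step j)
  then have "chain c x (Suc j) = chain c x j"
    by (simp add: next_dir_le)
  then show ?case
    using step turn_pos[of j] by simp
qed (use assms in simp)

text \<open>If every single step turns by less than \<open>2 * pi / n\<close>, the chain does not complete a turn.\<close>
lemma chain_small:
  assumes "x < \<tau> 0 + pi"
  shows "\<exists>c>0. chain c x n < x + 2 * pi"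
proof -
  define d where "d = 2 * pi / n"
  have d: "0 < d" "d < pi" "n * d = 2 * pi"
    using three_le by (auto simp: d_def field_simps)
  have "0 < d * sin d"
    using d by (simp add: sin_gt_zero)
  have W: "0 \<le> sum w {..<n}"
    using weight_pos by (intro sum_nonneg) force
  \<comment> \<open>dividing by more than every weight makes all factors \<open>c * w k\<close> smaller than \<open>d * sin d\<close>\<close>
  define c where "c = d * sin d / (1 + sum w {..<n})"
  have c: "0 < c"
    using \<open>0 < d * sin d\<close> W by (simp add: c_def)
  have cw: "c * w k < d * sin d" if "k < n" for k
  proof -
    have "w k \<le> sum w {..<n}"
      using that weight_pos by (intro member_le_sum) force+
    then have "c * w k < c * (1 + sum w {..<n})"
      using c by simp
    then show ?thesis
      using W by (simp add: c_def)
  qed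
  have "chain c x k \<le> x + k * d \<and> (0 < k \<longrightarrow> chain c x k < x + k * d)" if "k \<le> n" for k
    using that
  proof (induction k)
    case (Suc k)
    have "chain c x (Suc k) < chain c x k + d"
      using next_dir_increment_less[of "chain c x k" "\<tau> k" d "c * w k"] chain_less[of x c k]
        c cw[of k] d assms weight_pos[of k] Suc.prems by simp
    then show ?case
      using Suc by (simp add: algebra_simps)
  qed simp
  from this[of n] show ?thesis
    using c d three_le by auto
qed

text \<open>
  For a large ratio a ray that points into the polygon forces the next one almost to its upper bound
  \<open>\<tau> k + pi\<close>, which is beyond the direction \<open>\<tau> (Suc k)\<close> of the next side; the argument can
  therefore be repeated along the chain.
\<close>
lemma chain_large:
  assumes "\<tau> 0 < x" "x < \<tau> 0 + pi" "k < n" "y < \<tau> k + pi"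
  shows "\<forall>\<^sub>F c in at_top. y < chain c x (Suc k)"
proof -
  have pos: "\<forall>\<^sub>F c::real in at_top. 0 < c"
    by (rule eventually_gt_at_top)
  have step: "\<forall>\<^sub>F c in at_top. y < chain c x (Suc k)"
    if k: "k < n" and y: "y < \<tau> k + pi" and z: "\<tau> k < z" "z < \<tau> k + pi"
      and ev: "\<forall>\<^sub>F c in at_top. z \<le> chain c x k" for k y z
    using ev pos eventually_less_next_dir[OF z y weight_pos[OF k]]
  proof eventually_elim
    case (elim c)
    note elim(3)
    also have "next_dir (\<tau> k) (c * w k) z \<le> chain c x (Suc k)"
      using elim chain_less[of x c k] assms weight_pos[OF k] k by (auto intro!: next_dir_mono)
    finally show ?case .
  qed
  show ?thesis
    using assms(3,4)
  proof (induction k arbitrary: y)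
    case 0
    then show ?case
      using step[of 0 y x] assms by simp
  next
    case (Suc k)
    obtain z where z: "\<tau> (Suc k) < z" "z < \<tau> k + pi"
      using turn_less[of k] Suc.prems dense by auto
    have "\<forall>\<^sub>F c in at_top. z < chain c x (Suc k)"
      using Suc z by simp
    then have "\<forall>\<^sub>F c in at_top. z \<le> chain c x (Suc k)"
      by eventually_elim simp
    then show ?case
      using step[of "Suc k" y z] z Suc.prems turn_pos[of k] by simp
  qed
qed

definition total_turn :: real where
  "total_turn = \<tau> n - \<tau> 0"

text \<open>
  The upper end is the constraint on the last ray \<open>\<psi> n < \<tau> (n - 1) + pi\<close>, moved back by a whole turn:
  the first ray has to stay inside the angle at vertex 0.
\<close>
definition start_dirs :: "real set" where
  "start_dirs = {\<tau> 0 <..< \<tau> (n - 1) + pi - total_turn}"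

definition closing_ratio :: "real \<Rightarrow> real" where
  "closing_ratio x = (THE c. 0 < c \<and> chain c x n = x + total_turn)"

lemma start_dirs_nonempty: "\<tau> 0 < \<tau> (n - 1) + pi - total_turn"
  using turn_less[of "n - 1"] three_le by (simp add: total_turn_def)

lemma start_dirs_bounds:
  assumes "x \<in> start_dirs"
  shows "\<tau> 0 < x" "x < \<tau> 0 + pi" "x + total_turn < \<tau> (n - 1) + pi"
  using assms turn_pos[of "n - 1"] three_le by (auto simp: start_dirs_def total_turn_def)

lemma chain_n_strict_mono:
  assumes "x \<in> start_dirs" "0 < c" "c < c'"
  shows "chain c x n < chain c' x n"
  using chain_strict_mono[of x c c' "n - 1"] start_dirs_bounds[OF assms(1)] assms three_le by simp

lemma closing_exists:
  assumes x: "x \<in> start_dirs"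
  shows "\<exists>c>0. chain c x n = x + total_turn"
proof -
  note xb = start_dirs_bounds[OF x]
  obtain c where c: "0 < c" "chain c x n < x + 2 * pi"
    using chain_small xb by blast
  have "\<forall>\<^sub>F c in at_top. x + total_turn < chain c x (Suc (n - 1))"
    using chain_large[of x "n - 1"] xb three_le by simp
  moreover have "\<forall>\<^sub>F c' in at_top. c < c'"
    by (rule eventually_gt_at_top)
  ultimately have "\<forall>\<^sub>F c' in at_top. c < c' \<and> x + total_turn < chain c' x (Suc (n - 1))"
    by eventually_elim simp
  then obtain c' where c': "c < c'" "x + total_turn < chain c' x (Suc (n - 1))"
    using eventually_happens trivial_limit_at_top_linorder by blast
  have "continuous_on {c..c'} (\<lambda>c. chain c x n)"
    unfolding continuous_on_def using c xb
    by (auto intro!: tendsto_chain tendsto_intros)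
  moreover have "chain c x n \<le> x + total_turn" "x + total_turn \<le> chain c' x n"
    using c c' full_turn three_le by (auto simp: total_turn_def)
  ultimately obtain d where "c \<le> d" "chain d x n = x + total_turn"
    using IVT'[of "\<lambda>c. chain c x n" c "x + total_turn" c'] c' by auto
  then show ?thesis
    using c by (intro exI[of _ d]) auto
qed

lemma closing_ratio:
  assumes x: "x \<in> start_dirs"
  shows closing_pos: "0 < closing_ratio x" and chain_closing: "chain (closing_ratio x) x n = x + total_turn"
proof -
  obtain c where c: "0 < c" "chain c x n = x + total_turn"
    using closing_exists[OF x] by blast
  have "closing_ratio x = c"
    unfolding closing_ratio_def
  proof (rule the_equality)
    show "d = c" if "0 < d \<and> chain d x n = x + total_turn" for d
      using that c chain_n_strict_mono[OF x, of c d] chain_n_strict_mono[OF x, of d c]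
      by (cases c d rule: linorder_cases) auto
  qed (use c in simp)
  then show "0 < closing_ratio x" "chain (closing_ratio x) x n = x + total_turn"
    using c by auto
qed

lemma less_closing_iff:
  assumes "x \<in> start_dirs" "0 < c"
  shows "c < closing_ratio x \<longleftrightarrow> chain c x n < x + total_turn" and "closing_ratio x < c \<longleftrightarrow> x + total_turn < chain c x n"
  using chain_n_strict_mono[OF assms(1), of c "closing_ratio x"] chain_n_strict_mono[OF assms(1), of "closing_ratio x" c]
    closing_ratio[OF assms(1)] assms(2)
  by (cases c "closing_ratio x" rule: linorder_cases; force)+

text \<open>An implicit function: the chain increases strictly with the ratio and, for a fixed ratio, depends
  continuously on the first direction.\<close>
lemma continuous_on_closing: "continuous_on start_dirs closing_ratio"
  unfolding continuous_on_def
proof (intro ballI order_tendstoI)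
  fix x c assume x: "x \<in> start_dirs"
  let ?F = "at x within start_dirs"
  have inF: "\<forall>\<^sub>F y in ?F. y \<in> start_dirs"
    by (simp add: eventually_at_filter)
  have lim: "((\<lambda>y. chain c y n - y) \<longlongrightarrow> chain c x n - x) ?F" if "0 < c" for c
    using start_dirs_bounds[OF x] that by (intro tendsto_diff tendsto_chain tendsto_intros) auto
  show "\<forall>\<^sub>F y in ?F. c < closing_ratio y" if c: "c < closing_ratio x"
  proof (cases "0 < c")
    case True
    then have "chain c x n - x < total_turn"
      using less_closing_iff[OF x] c by fastforce
    with lim[OF True] have "\<forall>\<^sub>F y in ?F. chain c y n - y < total_turn"
      using order_tendstoD by fastforce
    with inF show ?thesis
      by eventually_elim (use less_closing_iff(1) True in fastforce)
  next
    case False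
    from inF show ?thesis
      by eventually_elim (use closing_pos False in force)
  qed
  show "\<forall>\<^sub>F y in ?F. closing_ratio y < c" if c: "closing_ratio x < c"
  proof -
    have c0: "0 < c"
      using closing_pos[OF x] c by simp
    then have "total_turn < chain c x n - x"
      using less_closing_iff[OF x] c by fastforce
    with lim[OF c0] have "\<forall>\<^sub>F y in ?F. total_turn < chain c y n - y"
      using order_tendstoD by fastforce
    with inF show ?thesis
      by eventually_elim (use less_closing_iff(2) c0 in fastforce)
  qed
qed

definition ray_dir :: "nat \<Rightarrow> real \<Rightarrow> real" where
  "ray_dir k x = chain (closing_ratio x) x k"

lemma ray_dir_0: "ray_dir 0 x = x"
  by (simp add: ray_dir_def)

lemma ray_dir_n: "x \<in> start_dirs \<Longrightarrow> ray_dir n x = x + total_turn"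
  by (simp add: ray_dir_def chain_closing)

lemma continuous_on_ray_dir:
  assumes "k \<le> n"
  shows "continuous_on start_dirs (ray_dir k)"
  unfolding continuous_on_def ray_dir_def
  using assms start_dirs_bounds closing_pos continuous_on_closing
  by (auto intro!: tendsto_chain tendsto_intros simp: continuous_on_def)

lemma side_less_ray_dir:
  assumes x: "x \<in> start_dirs" and k: "k \<le> n"
  shows "\<tau> k < ray_dir k x"
proof (rule ccontr)
  assume "\<not> \<tau> k < ray_dir k x"
  then have "chain (closing_ratio x) x n \<le> \<tau> n"
    using chain_stuck[of "closing_ratio x" x k n] k by (simp add: ray_dir_def)
  then show False
    using chain_closing[OF x] start_dirs_bounds[OF x] by (simp add: total_turn_def)
qed

lemma
  assumes x: "x \<in> start_dirs" and k: "k < n"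
  shows ray_dir_less_Suc: "ray_dir k x < ray_dir (Suc k) x"
    and ray_dir_Suc_less: "ray_dir (Suc k) x < \<tau> k + pi"
    and ray_dir_proportional: "(ray_dir (Suc k) x - ray_dir k x) * sin (ray_dir (Suc k) x - ray_dir k x)
      = closing_ratio x * w k * sin (ray_dir k x - \<tau> k) * sin (ray_dir (Suc k) x - \<tau> k)"
proof -
  have "\<tau> k < ray_dir k x"
    using side_less_ray_dir x k by simp
  moreover have "ray_dir k x < \<tau> k + pi"
    using chain_less[of x "closing_ratio x" k] start_dirs_bounds[OF x] closing_pos[OF x] k by (simp add: ray_dir_def)
  moreover have "0 < closing_ratio x * w k"
    using closing_pos[OF x] weight_pos[OF k] by simp
  moreover have "ray_dir (Suc k) x = next_dir (\<tau> k) (closing_ratio x * w k) (ray_dir k x)"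
    by (simp add: ray_dir_def)
  ultimately show "ray_dir k x < ray_dir (Suc k) x" "ray_dir (Suc k) x < \<tau> k + pi"
    "(ray_dir (Suc k) x - ray_dir k x) * sin (ray_dir (Suc k) x - ray_dir k x)
      = closing_ratio x * w k * sin (ray_dir k x - \<tau> k) * sin (ray_dir (Suc k) x - \<tau> k)"
    using next_dir_root[of "\<tau> k" "ray_dir k x" "closing_ratio x * w k"] by (auto simp: defect_def)
qed

text \<open>
  With a bounded ratio, the solution \<open>ray_dir 1 x\<close> would follow \<open>x\<close> down to \<open>\<tau> 0\<close>; but it stays above
  \<open>\<tau> 1\<close>.
\<close>
lemma closing_large_left: "\<forall>\<^sub>F x in at_right (\<tau> 0). C < closing_ratio x"
proof -
  \<comment> \<open>a ratio has to be positive for the comparison of solutions\<close>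
  define C' where "C' = max C 1"
  have n: "0 < n" "Suc 0 \<le> n"
    using three_le by auto
  have g: "\<tau> 0 < \<tau> 1" "\<tau> 1 < \<tau> 0 + pi"
    using turn_pos[of 0] turn_less[of 0] n by auto
  have "defect (\<tau> 0) (C' * w 0) (\<tau> 0) (\<tau> 1) > 0"
    using g by (simp add: defect_def sin_gt_zero)
  moreover have "((\<lambda>x. defect (\<tau> 0) (C' * w 0) x (\<tau> 1)) \<longlongrightarrow> defect (\<tau> 0) (C' * w 0) (\<tau> 0) (\<tau> 1)) (at_right (\<tau> 0))"
    unfolding defect_def by (intro tendsto_intros)
  ultimately have "\<forall>\<^sub>F x in at_right (\<tau> 0). 0 < defect (\<tau> 0) (C' * w 0) x (\<tau> 1)"
    using order_tendstoD by blast
  moreover have "\<forall>\<^sub>F x in at_right (\<tau> 0). x \<in> {\<tau> 0 <..< \<tau> 1}"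
    using g by (intro eventually_at_right_real)
  moreover have "\<forall>\<^sub>F x in at_right (\<tau> 0). x \<in> start_dirs"
    unfolding start_dirs_def using start_dirs_nonempty by (intro eventually_at_right_real)
  ultimately show ?thesis
  proof eventually_elim
    case (elim x)
    show ?case
    proof (rule ccontr)
      assume "\<not> C < closing_ratio x"
      then have "closing_ratio x * w 0 \<le> C' * w 0"
        using weight_pos[of 0] n by (simp add: C'_def)
      then have "ray_dir 1 x \<le> next_dir (\<tau> 0) (C' * w 0) x"
        using next_dir_mono_factor[of x "\<tau> 0" "closing_ratio x * w 0" "C' * w 0"]
          closing_pos weight_pos[of 0] n elim g
        by (simp add: ray_dir_def)
      also have "\<dots> < \<tau> 1"
        using next_dir_less_iff[of "\<tau> 0" x "\<tau> 1" "C' * w 0"] elim g weight_pos[of 0] n by (simp add: C'_def)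
      finally show False
        using side_less_ray_dir[of x 1] elim n by simp
    qed
  qed
qed

text \<open>
  Here the last triangle degenerates: its left ray stays below \<open>\<tau> (n - 2) + pi\<close>, so with a bounded ratio
  its right ray stays below the solution that belongs to this bound, which is less than \<open>\<tau> (n - 1) + pi\<close>.
\<close>
lemma closing_large_right: "\<forall>\<^sub>F x in at_left (\<tau> (n - 1) + pi - total_turn). C < closing_ratio x"
proof -
  \<comment> \<open>a ratio has to be positive for the comparison of solutions\<close>
  define C' where "C' = max C 1"
  define m where "m = n - 2"
  have m: "n = Suc (Suc m)"
    using three_le by (simp add: m_def)
  have w: "0 < w (Suc m)"
    using weight_pos m by simp
  define y where "y = next_dir (\<tau> (Suc m)) (C' * w (Suc m)) (\<tau> m + pi)"
  have y: "y < \<tau> (n - 1) + pi"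
    using next_dir_bounds(2)[of "\<tau> m + pi" "\<tau> (Suc m)" "C' * w (Suc m)"] turn_pos[of m] w m
    by (simp add: y_def C'_def)
  have "\<forall>\<^sub>F x in at_left (\<tau> (n - 1) + pi - total_turn). x \<in> {y - total_turn <..< \<tau> (n - 1) + pi - total_turn}"
    using y by (intro eventually_at_left_real) simp
  moreover have "\<forall>\<^sub>F x in at_left (\<tau> (n - 1) + pi - total_turn). x \<in> start_dirs"
    unfolding start_dirs_def using start_dirs_nonempty by (intro eventually_at_left_real)
  ultimately show ?thesis
  proof eventually_elim
    case (elim x)
    note xb = start_dirs_bounds[OF elim(2)]
    show ?case
    proof (rule ccontr)
      assume "\<not> C < closing_ratio x"
      then have c: "closing_ratio x * w (Suc m) \<le> C' * w (Suc m)"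
        using w by (simp add: C'_def)
      have r: "ray_dir (Suc m) x < \<tau> m + pi"
        using ray_dir_Suc_less[OF elim(2), of m] m by simp
      have "chain c x n = next_dir (\<tau> (Suc m)) (c * w (Suc m)) (chain c x (Suc m))" for c
        by (simp add: m)
      then have "x + total_turn = next_dir (\<tau> (Suc m)) (closing_ratio x * w (Suc m)) (ray_dir (Suc m) x)"
        using chain_closing[OF elim(2)] unfolding ray_dir_def by metis
      also have "\<dots> \<le> next_dir (\<tau> (Suc m)) (C' * w (Suc m)) (ray_dir (Suc m) x)"
        using c r turn_pos[of m] m w closing_pos[OF elim(2)] by (intro next_dir_mono_factor) auto
      also have "\<dots> \<le> y"
        unfolding y_def using r turn_pos[of m] m w by (intro next_dir_mono) (auto simp: C'_def)
      finally show False
        using elim by simp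
    qed
  qed
qed

end

section \<open>The triangle cut off by two rays\<close>

text \<open>The identification of the two planes preserves area; this transports the area formula for triangles
  from \<open>real ^ 2\<close> to the complex numbers.\<close>
lemma lborel_complex_eq_distr:
  "(lborel :: complex measure) = distr lborel borel (\<lambda>v :: real ^ 2. Complex (v $ 1) (v $ 2))"
proof (rule lborel_eqI)
  let ?f = "\<lambda>v :: real ^ 2. Complex (v $ 1) (v $ 2)"
  have "?f = (\<lambda>v. complex_of_real (v $ 1) + \<i> * complex_of_real (v $ 2))"
    by (auto simp: complex_eq_iff)
  moreover have "continuous_on UNIV \<dots>"
    by (intro continuous_intros)
  ultimately have meas: "?f \<in> borel_measurable borel"
    using borel_measurable_continuous_onI by simp
  fix l u :: complex
  assume lu: "\<And>b. b \<in> Basis \<Longrightarrow> l \<bullet> b \<le> u \<bullet> b"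
  let ?g = "\<lambda>z. \<chi> i::2. if i = 1 then Re z else Im z"
  have le: "Re l \<le> Re u" "Im l \<le> Im u"
    using lu[of 1] lu[of \<i>] by (auto simp: Basis_complex_def)
  have pre: "?f -` box l u = box (?g l) (?g u)"
    by (auto simp: box_def Basis_complex_def Basis_vec_def inner_axis forall_2)
  have "emeasure (distr lborel borel ?f) (box l u) = emeasure lborel (box (?g l) (?g u))"
    using meas pre by (subst emeasure_distr) auto
  also have "\<dots> = ennreal (\<Prod>b\<in>Basis. (?g u - ?g l) \<bullet> b)"
    using le by (intro emeasure_lborel_box) (auto simp: Basis_vec_def inner_axis)
  also have "(\<Prod>b\<in>Basis. (?g u - ?g l) \<bullet> b) = (Re u - Re l) * (Im u - Im l)"
  proof -
    have B: "(Basis :: (real^2) set) = {axis 1 1, axis 2 1}" and ne: "axis 1 1 \<noteq> (axis 2 1 :: real^2)"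
      by (auto simp: Basis_vec_def axis_eq_axis) (metis exhaust_2)
    show ?thesis
      unfolding B using ne by (simp add: inner_axis)
  qed
  also have "\<dots> = (\<Prod>b\<in>Basis. (u - l) \<bullet> b)"
    by (simp add: Basis_complex_def)
  finally show "emeasure (distr lborel borel ?f) (box l u) = ennreal (\<Prod>b\<in>Basis. (u - l) \<bullet> b)" .
qed simp

lemma measure_triangle_complex:
  fixes a b p :: complex
  shows "measure lebesgue (interior (convex hull {a, b, p})) = \<bar>Im (cnj (b - a) * (p - a))\<bar> / 2"
proof -
  let ?f = "\<lambda>v :: real ^ 2. Complex (v $ 1) (v $ 2)"
  let ?g = "\<lambda>z. \<chi> i::2. if i = 1 then Re z else Im z"
  have lin: "linear ?f" "linear ?g"
    by (auto intro!: linearI simp: complex_eq_iff vec_eq_iff)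
  have fg: "?f (?g z) = z" "?g (?f v) = v" for z v
    by (auto simp: complex_eq_iff vec_eq_iff forall_2)
  have comp: "compact (convex hull {a, b, p})"
    by (intro finite_imp_compact_convex_hull) simp
  have "measure lebesgue (interior (convex hull {a, b, p})) = measure lebesgue (convex hull {a, b, p})"
    by (intro measure_interior negligible_convex_frontier compact_imp_bounded[OF comp]) simp
  also have "\<dots> = measure lborel (convex hull {a, b, p})"
    using comp by (simp add: measure_completion borel_compact)
  also have "\<dots> = measure lborel (?f -` (convex hull {a, b, p}))"
  proof -
    have "?f \<in> borel_measurable borel"
      using linear_continuous_on linear_linear lin(1) borel_measurable_continuous_onI by blast
    then show ?thesis
      using comp by (subst lborel_complex_eq_distr, subst measure_distr) (auto simp: borel_compact)
  qed
  also have "?f -` (convex hull {a, b, p}) = ?g ` (convex hull {a, b, p})"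
    using fg by (auto simp: image_iff) metis
  also have "\<dots> = convex hull {?g a, ?g b, ?g p}"
    using convex_hull_linear_image[OF lin(2), of "{a, b, p}"] by simp
  also have "measure lborel \<dots> = \<bar>Im (cnj (b - a) * (p - a))\<bar> / 2"
    by (subst content_triangle) (simp add: algebra_simps abs_minus_commute)
  finally show ?thesis .
qed

text \<open>The signed distance of \<open>z\<close> from the line through \<open>a\<close> in direction \<open>s\<close>, positive on the left.\<close>
definition left_offset :: "real \<Rightarrow> complex \<Rightarrow> complex \<Rightarrow> real" where
  "left_offset s a z = Im (cis (- s) * (z - a))"

lemma left_offset_eq: "left_offset s a z = Im (z - a) * cos s - Re (z - a) * sin s"
  by (simp add: left_offset_def)

lemma left_offset_convex_comb:
  assumes "u + v + w = 1"
  shows "left_offset s a (u *\<^sub>R x + v *\<^sub>R y + w *\<^sub>R z)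
    = u * left_offset s a x + v * left_offset s a y + w * left_offset s a z"
proof -
  have u: "u = 1 - v - w"
    using assms by simp
  show ?thesis
    unfolding u left_offset_eq by (simp add: algebra_simps)
qed

lemma left_offset_polar: "left_offset s a (a + r *\<^sub>R cis u) = r * sin (u - s)"
  by (simp add: left_offset_eq sin_diff algebra_simps)

lemma offset_expansion:
  "sin (x - t) *\<^sub>R (z - a) = left_offset t a z *\<^sub>R cis x - left_offset x a z *\<^sub>R cis t"
  by (simp add: complex_eq_iff left_offset_eq sin_diff algebra_simps)

lemma continuous_on_left_offset [continuous_intros]:
  fixes f :: "real \<Rightarrow> real"
  assumes "continuous_on S f"
  shows "continuous_on S (\<lambda>x. left_offset (f x) a z)"
  unfolding left_offset_eq by (intro continuous_intros assms)

lemma continuous_on_left_offset_point: "continuous_on S (left_offset s a)"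
  unfolding left_offset_eq by (intro continuous_intros)

lemma left_offset_cong_cis: "cis s = cis t \<Longrightarrow> left_offset s = left_offset t"
  by (auto simp: left_offset_def fun_eq_iff cis_cnj[symmetric])

text \<open>
  The base from \<open>a\<close> to \<open>b\<close> has direction \<open>t\<close>, the rays from \<open>a\<close> and \<open>b\<close> have directions \<open>x\<close> and \<open>y\<close>.
  The condition on the angles says that the rays start to the left of the base and meet there.
\<close>
locale ray_triangle =
  fixes a b :: complex and l t x y :: real
  assumes length_pos: "0 < l" and base: "b = a + l *\<^sub>R cis t"
    and angles: "t < x" "x < y" "y < t + pi"
begin

definition apex :: complex where
  "apex = a + (l * sin (y - t) / sin (y - x)) *\<^sub>R cis x"

lemma sines: "0 < sin (x - t)" "0 < sin (y - t)" "0 < sin (y - x)"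
  using angles by (auto intro!: sin_gt_zero)

text \<open>The law of sines, read from the other end point of the base.\<close>
lemma apex_from_right: "apex = b + (l * sin (x - t) / sin (y - x)) *\<^sub>R cis y"
proof -
  have "sin (y - t) *\<^sub>R cis x - sin (x - t) *\<^sub>R cis y = sin (y - x) *\<^sub>R cis t"
    by (simp add: complex_eq_iff sin_diff algebra_simps)
  then have "(l / sin (y - x)) *\<^sub>R (sin (y - t) *\<^sub>R cis x - sin (x - t) *\<^sub>R cis y) = l *\<^sub>R cis t"
    using sines by simp
  then show ?thesis
    by (simp add: apex_def base algebra_simps scaleR_diff_right)
qed

lemma left_offset_simps:
  "left_offset x a a = 0" "left_offset x a b = - l * sin (x - t)" "left_offset x a apex = 0"
  "left_offset y b a = l * sin (y - t)" "left_offset y b b = 0" "left_offset y b apex = 0"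
proof -
  have a: "a = a + 0 *\<^sub>R cis x" "b = b + 0 *\<^sub>R cis y" "a = b + (- l) *\<^sub>R cis t"
    by (simp_all add: base)
  show "left_offset x a a = 0" "left_offset y b b = 0"
    by (simp_all add: left_offset_def)
  show "left_offset x a b = - l * sin (x - t)"
    using left_offset_polar[of x a l t] sin_minus[of "x - t"] by (simp add: base)
  show "left_offset y b a = l * sin (y - t)"
    using left_offset_polar[of y b "- l" t] sin_minus[of "y - t"] a(3) by simp
  show "left_offset x a apex = 0"
    by (simp only: apex_def left_offset_polar) simp
  show "left_offset y b apex = 0"
    by (simp only: apex_from_right left_offset_polar) simp
qed

lemma offset_identity:
  "left_offset t a z * sin (y - x) - left_offset x a z * sin (y - t) + left_offset y b z * sin (x - t)
    = l * sin (x - t) * sin (y - t)"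
  by (simp add: left_offset_eq base sin_diff) algebra

text \<open>
  A barycentric coordinate is the distance from the opposite side, divided by the value of this distance
  at the vertex. The triangle is therefore described by the signs of three distances.
\<close>
lemma barycentric:
  assumes "u = left_offset y b z / (l * sin (y - t))"
    and "v = - left_offset x a z / (l * sin (x - t))"
    and "w = left_offset t a z * sin (y - x) / (l * sin (x - t) * sin (y - t))"
  shows "u + v + w = 1" "u *\<^sub>R a + v *\<^sub>R b + w *\<^sub>R apex = z"
proof -
  show one: "u + v + w = 1"
    using offset_identity[of z] sines length_pos by (simp add: assms field_simps)
  then have u: "u = 1 - v - w" by simp
  have "u *\<^sub>R a + v *\<^sub>R b + w *\<^sub>R apex = a + (v * l) *\<^sub>R cis t + (w * (l * sin (y - t) / sin (y - x))) *\<^sub>R cis x"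
    by (simp add: u base apex_def algebra_simps)
  also have "v * l = - left_offset x a z / sin (x - t)"
    using sines length_pos by (simp add: assms)
  also have "w * (l * sin (y - t) / sin (y - x)) = left_offset t a z / sin (x - t)"
    using sines length_pos by (simp add: assms)
  also have "a + (- left_offset x a z / sin (x - t)) *\<^sub>R cis t + (left_offset t a z / sin (x - t)) *\<^sub>R cis x
      = a + (1 / sin (x - t)) *\<^sub>R (left_offset t a z *\<^sub>R cis x - left_offset x a z *\<^sub>R cis t)"
    by (simp add: algebra_simps scaleR_diff_right)
  also have "\<dots> = z"
    using sines by (simp add: offset_expansion[symmetric])
  finally show "u *\<^sub>R a + v *\<^sub>R b + w *\<^sub>R apex = z" .
qed

lemma mem_triangle:
  assumes "0 \<le> left_offset t a z" "left_offset x a z \<le> 0" "0 \<le> left_offset y b z"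
  shows "z \<in> convex hull {a, b, apex}"
proof -
  obtain u v w where uvw: "u = left_offset y b z / (l * sin (y - t))"
    "v = - left_offset x a z / (l * sin (x - t))"
    "w = left_offset t a z * sin (y - x) / (l * sin (x - t) * sin (y - t))"
    by blast
  have "0 \<le> u" "0 \<le> v" "0 \<le> w"
    unfolding uvw using assms sines length_pos by (auto intro!: divide_nonneg_pos divide_nonpos_pos)
  then show ?thesis
    unfolding convex_hull_3 using barycentric[OF uvw] by blast
qed

lemma not_collinear: "\<not> collinear {a, b, apex}"
proof
  assume "collinear {a, b, apex}"
  then have "collinear {apex, b, a}"
    by (simp add: insert_commute)
  moreover have "b \<noteq> a"
    using base length_pos by auto
  ultimately obtain u where "apex = u *\<^sub>R b + (1 - u) *\<^sub>R a"
    using collinear_3_expand[of apex b a] by (metis collinear_3_expand insert_commute)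
  then have "left_offset x a apex = left_offset x a (u *\<^sub>R b + (1 - u) *\<^sub>R a + 0 *\<^sub>R a)"
    by simp
  also have "\<dots> = u * left_offset x a b"
    by (subst left_offset_convex_comb) (auto simp: left_offset_simps)
  finally have "u = 0"
    using sines length_pos by (simp add: left_offset_simps)
  then have "apex = a"
    using \<open>apex = _\<close> by simp
  then show False
    using sines length_pos by (simp add: apex_def)
qed

lemma mem_interior_triangle:
  assumes "0 < left_offset t a z" "left_offset x a z < 0" "0 < left_offset y b z"
  shows "z \<in> interior (convex hull {a, b, apex})"
proof -
  obtain u v w where uvw: "u = left_offset y b z / (l * sin (y - t))"
    "v = - left_offset x a z / (l * sin (x - t))"
    "w = left_offset t a z * sin (y - x) / (l * sin (x - t) * sin (y - t))"
    by blast
  have "0 < u" "0 < v" "0 < w"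
    unfolding uvw using assms sines length_pos by (auto intro!: divide_pos_pos divide_neg_pos)
  then show ?thesis
    using barycentric[OF uvw] interior_convex_hull_3_minimal[OF not_collinear] by auto
qed

text \<open>The distance of a point between the two rays from the base is at most the height of the
  triangle.\<close>
lemma height_le:
  assumes "left_offset x a z \<le> 0" "0 \<le> left_offset y b z"
  shows "left_offset t a z * sin (y - x) \<le> l * sin (x - t) * sin (y - t)"
proof -
  have "left_offset x a z * sin (y - t) \<le> 0" "0 \<le> left_offset y b z * sin (x - t)"
    using assms sines by (auto simp: mult_le_0_iff)
  then show ?thesis
    using offset_identity[of z] by linarith
qed

lemma midpoint_offsets:
  "left_offset x a (midpoint a b) < 0" "0 < left_offset y b (midpoint a b)"
proof -
  have "midpoint a b = a + (l / 2) *\<^sub>R cis t" "midpoint a b = b + (- l / 2) *\<^sub>R cis t"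
    by (simp_all add: base midpoint_def complex_eq_iff)
  then have "left_offset x a (midpoint a b) = l / 2 * sin (t - x)"
    "left_offset y b (midpoint a b) = - l / 2 * sin (t - y)"
    using left_offset_polar by metis+
  then have "left_offset x a (midpoint a b) = - (l * sin (x - t)) / 2"
    "left_offset y b (midpoint a b) = l * sin (y - t) / 2"
    using sin_minus[of "x - t"] sin_minus[of "y - t"] by simp_all
  then show "left_offset x a (midpoint a b) < 0" "0 < left_offset y b (midpoint a b)"
    using mult_pos_pos[OF length_pos sines(1)] mult_pos_pos[OF length_pos sines(2)] by linarith+
qed

lemma closure_interior_triangle: "closure (interior (convex hull {a, b, apex})) = convex hull {a, b, apex}"
proof -
  define c where "c = (1/3) *\<^sub>R a + (1/3) *\<^sub>R b + (1/3) *\<^sub>R apex"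
  have "c \<in> interior (convex hull {a, b, apex})"
    using interior_convex_hull_3_minimal[OF not_collinear]
    by (auto simp: c_def intro!: exI[of _ "1/3"])
  then have "closure (interior (convex hull {a, b, apex})) = closure (convex hull {a, b, apex})"
    by (intro convex_closure_interior) auto
  then show ?thesis
    by (simp add: finite_imp_compact_convex_hull compact_imp_closed)
qed

lemma apex_angle_eq: "angle_at apex a b = y - x"
proof -
  define r s where "r = l * sin (y - t) / sin (y - x)" and "s = l * sin (x - t) / sin (y - x)"
  have rs: "0 < r" "0 < s"
    using sines length_pos by (auto simp: r_def s_def)
  have d: "a - apex = - r *\<^sub>R cis x" "b - apex = - s *\<^sub>R cis y"
    by (simp add: apex_def r_def, simp add: apex_from_right s_def)
  have "(a - apex) \<bullet> (b - apex) = r * s * cos (y - x)"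
    by (simp add: d inner_complex_def cos_diff algebra_simps)
  moreover have "norm (a - apex) = r" "norm (b - apex) = s"
    using rs by (auto simp: d)
  ultimately show ?thesis
    using rs angles by (simp add: angle_at_def arccos_cos)
qed

lemma area_eq: "measure lebesgue (interior (convex hull {a, b, apex}))
  = l\<^sup>2 / 2 * sin (x - t) * sin (y - t) / sin (y - x)"
proof -
  have "Im (cnj (b - a) * (apex - a)) = l * (l * sin (y - t) / sin (y - x)) * sin (x - t)"
    by (simp add: base apex_def sin_diff algebra_simps)
  also have "\<dots> = l\<^sup>2 * sin (x - t) * sin (y - t) / sin (y - x)"
    by (simp add: power2_eq_square mult_ac)
  finally have double_area: "Im (cnj (b - a) * (apex - a)) = l\<^sup>2 * sin (x - t) * sin (y - t) / sin (y - x)" .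
  show ?thesis
    unfolding measure_triangle_complex double_area using sines length_pos by simp
qed

lemma left_of_right_ray:
  assumes "z \<in> convex hull {a, b, apex}"
  shows "0 \<le> left_offset y b z" "left_offset y b z = 0 \<Longrightarrow> z \<in> closed_segment b apex"
proof -
  obtain u v w where uvw: "0 \<le> u" "0 \<le> v" "0 \<le> w" "u + v + w = 1"
    and z: "z = u *\<^sub>R a + v *\<^sub>R b + w *\<^sub>R apex"
    using assms unfolding convex_hull_3 by blast
  have off: "left_offset y b z = u * (l * sin (y - t))"
    unfolding z left_offset_convex_comb[OF uvw(4)] by (simp add: left_offset_simps)
  then show "0 \<le> left_offset y b z"
    using uvw sines length_pos by simp
  show "z \<in> closed_segment b apex" if "left_offset y b z = 0"
  proof -
    have "u = 0" using that off sines length_pos by simp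
    then have "v = 1 - w" using uvw by simp
    then show ?thesis
      using uvw z \<open>u = 0\<close> by (auto simp: closed_segment_def intro!: exI[of _ w])
  qed
qed

lemma right_of_left_ray:
  assumes "z \<in> convex hull {a, b, apex}"
  shows "left_offset x a z \<le> 0" "left_offset x a z = 0 \<Longrightarrow> z \<in> closed_segment a apex"
proof -
  obtain u v w where uvw: "0 \<le> u" "0 \<le> v" "0 \<le> w" "u + v + w = 1"
    and z: "z = u *\<^sub>R a + v *\<^sub>R b + w *\<^sub>R apex"
    using assms unfolding convex_hull_3 by blast
  have off: "left_offset x a z = - v * (l * sin (x - t))"
    unfolding z left_offset_convex_comb[OF uvw(4)] by (simp add: left_offset_simps)
  then show "left_offset x a z \<le> 0"
    using uvw sines length_pos by simp
  show "z \<in> closed_segment a apex" if "left_offset x a z = 0"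
  proof -
    have "v = 0" using that off sines length_pos by simp
    then have "u = 1 - w" using uvw by simp
    then show ?thesis
      using uvw z \<open>v = 0\<close> by (auto simp: closed_segment_def intro!: exI[of _ w])
  qed
qed

end

lemma closed_segment_common_ray:
  fixes b d :: "'a::real_vector"
  assumes "0 \<le> r" "r \<le> s"
  shows "closed_segment b (b + r *\<^sub>R d) \<inter> closed_segment b (b + s *\<^sub>R d) = closed_segment b (b + r *\<^sub>R d)"
proof -
  have "b + r *\<^sub>R d \<in> closed_segment b (b + s *\<^sub>R d)"
  proof (cases "s = 0")
    case False
    then have "b + r *\<^sub>R d = (1 - r / s) *\<^sub>R b + (r / s) *\<^sub>R (b + s *\<^sub>R d)"
      by (simp add: algebra_simps)
    then show ?thesis
      unfolding closed_segment_def using assms False by (auto intro!: exI[of _ "r / s"])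
  qed (use assms in auto)
  then show ?thesis
    by (meson Int_absorb2 ends_in_segment(1) subset_closed_segment)
qed

text \<open>
  The triangles lie on different sides of the line of their common ray, so they meet only on it. Each of
  them has there a side that starts at \<open>b\<close>, and the shorter of these two segments is the intersection.
\<close>
lemma adjacent_triangles_inter:
  assumes T: "ray_triangle a b l t x y" and T': "ray_triangle b d l' t' y' z"
    and dir: "cis y' = cis y"
  defines "p \<equiv> ray_triangle.apex a l t x y" and "p' \<equiv> ray_triangle.apex b l' t' y' z"
  shows "convex hull {a, b, p} \<inter> convex hull {b, d, p'} \<in> {closed_segment b p, closed_segment p' b}"
proof -
  interpret T: ray_triangle a b l t x y by fact
  interpret T': ray_triangle b d l' t' y' z by fact
  define r s where "r = l * sin (x - t) / sin (y - x)" and "s = l' * sin (z - t') / sin (z - y')"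
  have rs: "0 \<le> r" "0 \<le> s"
    using T.sines T'.sines T.length_pos T'.length_pos by (auto simp: r_def s_def)
  have p: "p = b + r *\<^sub>R cis y" "p' = b + s *\<^sub>R cis y"
    using T.apex_from_right T'.apex_def dir by (auto simp: p_def p'_def r_def s_def)
  have "left_offset y' b = left_offset y b"
    using left_offset_cong_cis[OF dir] by simp
  then have "convex hull {a, b, p} \<inter> convex hull {b, d, p'} \<subseteq> closed_segment b p \<inter> closed_segment b p'"
    using T.left_of_right_ray T'.right_of_left_ray unfolding p_def p'_def
    by (auto intro: antisym) (metis antisym)+
  moreover have "closed_segment b p \<subseteq> convex hull {a, b, p}" "closed_segment b p' \<subseteq> convex hull {b, d, p'}"
    by (rule closed_segment_subset; simp add: hull_inc)+
  ultimately have eq: "convex hull {a, b, p} \<inter> convex hull {b, d, p'} = closed_segment b p \<inter> closed_segment b p'"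
    by blast
  show ?thesis
  proof (cases "r \<le> s")
    case True
    then show ?thesis
      unfolding eq using closed_segment_common_ray[of r s b "cis y"] rs p by simp
  next
    case False
    then show ?thesis
      unfolding eq using closed_segment_common_ray[of s r b "cis y"] rs p
      by (simp add: Int_commute closed_segment_commute)
  qed
qed

section \<open>A covering system in the family\<close>

text \<open>Starting from any index with \<open>f i \<le> 0\<close>, negativity spreads around the whole cycle.\<close>
lemma cyclic_sign:
  fixes f :: "nat \<Rightarrow> real"
  assumes step: "\<And>k. k < n \<Longrightarrow> f k \<le> 0 \<Longrightarrow> f (Suc k mod n) < 0"
  shows "(\<forall>k<n. 0 < f k) \<or> (\<forall>k<n. f k < 0)"
proof (cases "\<forall>k<n. 0 < f k")
  case False
  then obtain i where i: "i < n" "f i \<le> 0"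
    by force
  have "f ((i + Suc j) mod n) < 0" for j
  proof (induction j)
    case 0
    then show ?case
      using step[OF i] by simp
  next
    case (Suc j)
    then show ?case
      using step[of "(i + Suc j) mod n"] i by (simp add: mod_Suc_eq)
  qed
  note neg = this
  have "f k < 0" if "k < n" for k
  proof -
    have "i + Suc (k + n - Suc i) = k + n"
      using i by simp
    then show ?thesis
      using neg[of "k + n - Suc i"] that by simp
  qed
  then show ?thesis
    by blast
qed simp

text \<open>
  The part of the geometry of a convex polygon on which the argument is based. The condition on midpoints
  gives every triangle points in common with \<open>D\<close>: near the midpoint of its base it contains all points to
  the left of the base.
\<close>
locale convex_polygon = side_directions n \<tau> "\<lambda>k. (l k)\<^sup>2 / 2"
  for n :: nat and \<tau> l :: "nat \<Rightarrow> real" +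
  fixes A :: "nat \<Rightarrow> complex" and D :: "complex set"
  assumes side_pos: "k < n \<Longrightarrow> 0 < l k"
    and side: "k < n \<Longrightarrow> A (Suc k mod n) = A k + l k *\<^sub>R cis (\<tau> k)"
    and cis_closed: "cis (\<tau> n) = cis (\<tau> 0)"
    and left_of_sides: "k < n \<Longrightarrow> z \<in> D \<Longrightarrow> 0 < left_offset (\<tau> k) (A k) z"
    and midpoint_closure: "k < n \<Longrightarrow> midpoint (A k) (A (Suc k mod n)) \<in> closure D"
    and nonempty: "D \<noteq> {}"
begin

definition apexes :: "real \<Rightarrow> nat \<Rightarrow> complex" where
  "apexes x k = ray_triangle.apex (A k) (l k) (\<tau> k) (ray_dir k x) (ray_dir (Suc k) x)"

definition ray_offset :: "nat \<Rightarrow> real \<Rightarrow> complex \<Rightarrow> real" where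
  "ray_offset k x z = left_offset (ray_dir k x) (A k) z"

lemma n_pos: "0 < n"
  using three_le by simp

lemma cis_total_turn: "cis total_turn = 1"
  using cis_closed by (simp add: total_turn_def cis_divide[symmetric])

lemma cis_ray_dir_mod:
  assumes "x \<in> start_dirs" "k < n"
  shows "cis (ray_dir (Suc k mod n) x) = cis (ray_dir (Suc k) x)"
proof (cases "Suc k = n")
  case True
  have "cis (ray_dir (Suc k) x) = cis x * cis total_turn"
    using True ray_dir_n[OF assms(1)] by (simp add: cis_mult)
  then show ?thesis
    using True by (simp add: ray_dir_0 cis_total_turn)
next
  case False
  then show ?thesis
    using assms by simp
qed

lemma ray_offset_Suc_mod:
  assumes "x \<in> start_dirs" "k < n"
  shows "ray_offset (Suc k mod n) x z = left_offset (ray_dir (Suc k) x) (A (Suc k mod n)) z"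
  using left_offset_cong_cis[OF cis_ray_dir_mod[OF assms]] by (simp add: ray_offset_def)

lemma triangle:
  assumes "x \<in> start_dirs" "k < n"
  shows "ray_triangle (A k) (A (Suc k mod n)) (l k) (\<tau> k) (ray_dir k x) (ray_dir (Suc k) x)"
  using assms side side_pos side_less_ray_dir[of x k] ray_dir_less_Suc[of x k] ray_dir_Suc_less[of x k]
  by unfold_locales auto

lemma closure_base_triangle:
  assumes "x \<in> start_dirs" "k < n"
  shows "closure (base_triangle n A (apexes x) k) = convex hull {A k, A (Suc k mod n), apexes x k}"
  unfolding base_triangle_def apexes_def
  using ray_triangle.closure_interior_triangle[OF triangle[OF assms]] by simp

lemma admissible:
  assumes x: "x \<in> start_dirs"
  shows "admissible_system n A D (apexes x)"
  unfolding admissible_system_def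
proof (intro allI impI conjI)
  fix k assume k: "k < n"
  interpret T: ray_triangle "A k" "A (Suc k mod n)" "l k" "\<tau> k" "ray_dir k x" "ray_dir (Suc k) x"
    by (rule triangle[OF x k])
  have P: "apexes x k = T.apex"
    by (simp add: apexes_def)
  show "\<not> collinear {A k, A (Suc k mod n), apexes x k}"
    unfolding P by (rule T.not_collinear)
  \<comment> \<open>the open angular region between the two rays; \<open>D\<close> lies to the left of the base, so the part of
    \<open>D\<close> in this region belongs to the triangle\<close>
  define W where "W = {z. left_offset (ray_dir k x) (A k) z < 0} \<inter>
    {z. 0 < left_offset (ray_dir (Suc k) x) (A (Suc k mod n)) z}"
  have "open W"
    unfolding W_def by (intro open_Int open_Collect_less continuous_on_left_offset_point continuous_intros)
  moreover have "midpoint (A k) (A (Suc k mod n)) \<in> W"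
    using T.midpoint_offsets by (simp add: W_def)
  ultimately have "W \<inter> D \<noteq> {}"
    using midpoint_closure[OF k] open_Int_closure_eq_empty[of W D] by blast
  then show "base_triangle n A (apexes x) k \<inter> D \<noteq> {}"
    unfolding base_triangle_def P using T.mem_interior_triangle left_of_sides[OF k]
    by (fastforce simp: W_def)
  let ?k = "Suc k mod n"
  have k': "?k < n"
    using n_pos by simp
  have "convex hull {A k, A ?k, apexes x k} \<inter> convex hull {A ?k, A (Suc ?k mod n), apexes x ?k}
      \<in> {closed_segment (A ?k) (apexes x k), closed_segment (apexes x ?k) (A ?k)}"
    unfolding apexes_def
    by (rule adjacent_triangles_inter[OF triangle[OF x k] triangle[OF x k'] cis_ray_dir_mod[OF x k]])
  then have "closure (base_triangle n A (apexes x) k) \<inter> closure (base_triangle n A (apexes x) ?k)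
      \<in> triangle_sides n A (apexes x) k \<union> triangle_sides n A (apexes x) ?k"
    unfolding closure_base_triangle[OF x k] closure_base_triangle[OF x k'] triangle_sides_def
    by blast
  then show "\<exists>S\<in>triangle_sides n A (apexes x) k \<union> triangle_sides n A (apexes x) ?k.
      closure (base_triangle n A (apexes x) k) \<inter> closure (base_triangle n A (apexes x) ?k) = S"
    by blast
qed

lemma proportional:
  assumes x: "x \<in> start_dirs"
  shows "proportional_system n A D (apexes x)"
proof -
  have "apex_angle n A (apexes x) k / measure lebesgue (base_triangle n A (apexes x) k) = closing_ratio x"
    if k: "k < n" for k
  proof -
    interpret T: ray_triangle "A k" "A (Suc k mod n)" "l k" "\<tau> k" "ray_dir k x" "ray_dir (Suc k) x"
      by (rule triangle[OF x k])
    have P: "apexes x k = T.apex"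
      by (simp add: apexes_def)
    define s where "s = (l k)\<^sup>2 / 2 * sin (ray_dir k x - \<tau> k) * sin (ray_dir (Suc k) x - \<tau> k)"
    have "0 < s"
      using T.sines T.length_pos by (simp add: s_def)
    have "measure lebesgue (base_triangle n A (apexes x) k) = s / sin (ray_dir (Suc k) x - ray_dir k x)"
      unfolding base_triangle_def P T.area_eq by (simp add: s_def)
    moreover have "apex_angle n A (apexes x) k = ray_dir (Suc k) x - ray_dir k x"
      unfolding apex_angle_def P by (rule T.apex_angle_eq)
    moreover have "(ray_dir (Suc k) x - ray_dir k x) * sin (ray_dir (Suc k) x - ray_dir k x) = closing_ratio x * s"
      using ray_dir_proportional[OF x k] by (simp add: s_def mult_ac)
    ultimately show ?thesis
      using \<open>0 < s\<close> by simp
  qed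
  then show ?thesis
    using admissible[OF x] by (auto simp: proportional_system_def)
qed

lemma uncovered_one_sided:
  assumes x: "x \<in> start_dirs" and z: "z \<in> D"
    and unc: "z \<notin> (\<Union>k<n. closure (base_triangle n A (apexes x) k))"
  shows "(\<forall>k<n. 0 < ray_offset k x z) \<or> (\<forall>k<n. ray_offset k x z < 0)"
proof (rule cyclic_sign)
  fix k assume k: "k < n" and right: "ray_offset k x z \<le> 0"
  interpret T: ray_triangle "A k" "A (Suc k mod n)" "l k" "\<tau> k" "ray_dir k x" "ray_dir (Suc k) x"
    by (rule triangle[OF x k])
  show "ray_offset (Suc k mod n) x z < 0"
  proof (rule ccontr)
    assume "\<not> ray_offset (Suc k mod n) x z < 0"
    then have "z \<in> convex hull {A k, A (Suc k mod n), apexes x k}"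
      using T.mem_triangle[of z] left_of_sides[OF k z] right ray_offset_Suc_mod[OF x k]
      by (simp add: apexes_def ray_offset_def)
    then show False
      using unc closure_base_triangle[OF x k] k by auto
  qed
qed

text \<open>
  The height of the \<open>k\<close>-th triangle is \<open>l k\<close> * apex angle / (ratio * \<open>(l k)\<^sup>2 / 2\<close>). If the ratio is so
  large that all heights are smaller than the distances of \<open>z\<close> from the sides, no triangle contains \<open>z\<close>.
\<close>
lemma flat_triangles_one_sided:
  assumes x: "x \<in> start_dirs" and z: "z \<in> D"
    and large: "\<And>k. k < n \<Longrightarrow> l k * pi / ((l k)\<^sup>2 / 2 * left_offset (\<tau> k) (A k) z) < closing_ratio x"
  shows "(\<forall>k<n. 0 < ray_offset k x z) \<or> (\<forall>k<n. ray_offset k x z < 0)"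
proof (rule cyclic_sign)
  fix k assume k: "k < n" and right: "ray_offset k x z \<le> 0"
  interpret T: ray_triangle "A k" "A (Suc k mod n)" "l k" "\<tau> k" "ray_dir k x" "ray_dir (Suc k) x"
    by (rule triangle[OF x k])
  define \<alpha> where "\<alpha> = ray_dir (Suc k) x - ray_dir k x"
  define p q where "p = sin (ray_dir k x - \<tau> k)" and "q = sin (ray_dir (Suc k) x - \<tau> k)"
  define d where "d = left_offset (\<tau> k) (A k) z"
  define K where "K = closing_ratio x * ((l k)\<^sup>2 / 2)"
  have d: "0 < d"
    using left_of_sides[OF k z] by (simp add: d_def)
  have K: "0 < K"
    using closing_pos[OF x] side_pos[OF k] by (simp add: K_def)
  have \<alpha>: "\<alpha> < pi" "0 < sin \<alpha>"
    using T.angles T.sines by (auto simp: \<alpha>_def)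
  show "ray_offset (Suc k mod n) x z < 0"
  proof (rule ccontr)
    assume "\<not> ray_offset (Suc k mod n) x z < 0"
    then have "d * sin \<alpha> \<le> l k * p * q"
      using T.height_le[of z] right ray_offset_Suc_mod[OF x k]
      by (simp add: ray_offset_def d_def \<alpha>_def p_def q_def)
    then have "K * (d * sin \<alpha>) \<le> K * (l k * p * q)"
      using K by simp
    also have "\<dots> = l k * (K * p * q)"
      by simp
    also have "K * p * q = \<alpha> * sin \<alpha>"
      using ray_dir_proportional[OF x k] by (simp add: K_def \<alpha>_def p_def q_def mult_ac)
    finally have "(K * d) * sin \<alpha> \<le> (l k * \<alpha>) * sin \<alpha>"
      by (simp add: mult_ac)
    then have "K * d \<le> l k * \<alpha>"
      using \<alpha> by simp
    also have "\<dots> < l k * pi"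
      using \<alpha> side_pos[OF k] by simp
    finally show False
      using large[OF k] d side_pos[OF k] by (simp add: K_def d_def[symmetric] field_simps)
  qed
qed

text \<open>
  If \<open>z\<close> is left and \<open>z'\<close> right of all rays, then the vector \<open>z - z'\<close> points to the left of all their
  directions. As consecutive directions differ by less than \<open>pi\<close>, the angle \<open>\<eta>\<close> of this vector cannot be
  overtaken by the directions of the rays while they perform a full turn.
\<close>
lemma not_left_and_right:
  assumes x: "x \<in> start_dirs" and left: "\<forall>k<n. 0 < ray_offset k x z" and right: "\<forall>k<n. ray_offset k x z' < 0"
  shows False
proof -
  define v where "v = z - z'"
  have "0 < Im (cis (- ray_dir k x) * v)" if "k < n" for k
  proof -
    have "ray_offset k x z' < ray_offset k x z"
      using left right that by (meson less_trans)
    then show ?thesis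
      by (simp add: ray_offset_def left_offset_def v_def algebra_simps)
  qed
  note pos = this
  \<comment> \<open>the angle of \<open>v\<close>, lifted so that it lies between \<open>x\<close> and \<open>x + pi\<close>\<close>
  define \<eta> where "\<eta> = x + Arg (cis (- x) * v)"
  have Im0: "0 < Im (cis (- x) * v)"
    using pos[of 0] n_pos by (simp add: ray_dir_0)
  then have \<eta>: "0 < \<eta> - x" "\<eta> - x < pi"
    using Arg_lt_pi[of "cis (- x) * v"] by (auto simp: \<eta>_def)
  have "cis (\<eta> - x) = sgn (cis (- x) * v)"
    using Im0 by (auto simp: \<eta>_def intro!: cis_Arg)
  then have v: "cis (- x) * v = cmod v *\<^sub>R cis (\<eta> - x)"
    using Im0 by (cases "v = 0") (simp_all add: sgn_div_norm norm_mult)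
  have "v = cis x * (cis (- x) * v)"
    by (simp add: mult.assoc[symmetric] cis_mult)
  also have "\<dots> = cmod v *\<^sub>R cis \<eta>"
    unfolding v by (simp add: cis_mult)
  finally have v': "v = cmod v *\<^sub>R cis \<eta>" .
  have sin_pos: "0 < sin (\<eta> - ray_dir k x)" if "k < n" for k
  proof -
    have "Im (cis (- ray_dir k x) * v) = cmod v * sin (\<eta> - ray_dir k x)"
      by (subst v') (simp add: sin_diff algebra_simps)
    then show ?thesis
      using pos[OF that] by (simp add: zero_less_mult_iff)
  qed
  have "0 < \<eta> - ray_dir k x" if "k < n" for k
    using that
  proof (induction k)
    case (Suc k)
    show ?case
    proof (rule ccontr)
      assume "\<not> 0 < \<eta> - ray_dir (Suc k) x"
      moreover have "ray_dir (Suc k) x < ray_dir k x + pi"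
        using ray_dir_Suc_less[OF x, of k] side_less_ray_dir[OF x, of k] Suc.prems by simp
      ultimately have "0 \<le> sin (- (\<eta> - ray_dir (Suc k) x))"
        using Suc by (intro sin_ge_zero) auto
      then show False
        using sin_pos[OF Suc.prems] unfolding sin_minus by simp
    qed
  qed (use \<eta> ray_dir_0 in simp)
  then have "ray_dir (n - 1) x < \<eta>"
    using n_pos by simp
  moreover have "ray_dir n x < ray_dir (n - 1) x + pi"
    using ray_dir_Suc_less[OF x, of "n - 1"] side_less_ray_dir[OF x, of "n - 1"] n_pos by simp
  ultimately show False
    using ray_dir_n[OF x] full_turn \<eta> by (simp add: total_turn_def)
qed

lemma open_one_sided:
  "open {x \<in> start_dirs. \<exists>z\<in>D. \<forall>k<n. 0 < ray_offset k x z}"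
  "open {x \<in> start_dirs. \<exists>z\<in>D. \<forall>k<n. ray_offset k x z < 0}"
proof -
  have o: "open start_dirs"
    by (simp add: start_dirs_def)
  have c: "continuous_on start_dirs (\<lambda>x. ray_offset k x z)" if "k < n" for k z
    unfolding ray_offset_def using that by (intro continuous_intros continuous_on_ray_dir) simp
  have "open (\<Union>z\<in>D. \<Inter>k<n. start_dirs \<inter> (\<lambda>x. ray_offset k x z) -` {0<..})"
    "open (\<Union>z\<in>D. \<Inter>k<n. start_dirs \<inter> (\<lambda>x. ray_offset k x z) -` {..<0})"
    by (intro open_UN ballI open_INT continuous_open_preimage c o; simp)+
  moreover have "{x \<in> start_dirs. \<exists>z\<in>D. \<forall>k<n. 0 < ray_offset k x z}
      = (\<Union>z\<in>D. \<Inter>k<n. start_dirs \<inter> (\<lambda>x. ray_offset k x z) -` {0<..})"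
    "{x \<in> start_dirs. \<exists>z\<in>D. \<forall>k<n. ray_offset k x z < 0}
      = (\<Union>z\<in>D. \<Inter>k<n. start_dirs \<inter> (\<lambda>x. ray_offset k x z) -` {..<0})"
    using n_pos by auto
  ultimately show "open {x \<in> start_dirs. \<exists>z\<in>D. \<forall>k<n. 0 < ray_offset k x z}"
    "open {x \<in> start_dirs. \<exists>z\<in>D. \<forall>k<n. ray_offset k x z < 0}"
    by simp_all
qed

lemma one_sided_exists:
  shows left_exists: "\<exists>x\<in>start_dirs. \<exists>z\<in>D. \<forall>k<n. 0 < ray_offset k x z"
    and right_exists: "\<exists>x\<in>start_dirs. \<exists>z\<in>D. \<forall>k<n. ray_offset k x z < 0"
proof -
  obtain z where z: "z \<in> D"
    using nonempty by blast
  define b where "b = \<tau> (n - 1) + pi - total_turn"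
  define c where "c k = l k * pi / ((l k)\<^sup>2 / 2 * left_offset (\<tau> k) (A k) z)" for k
  \<comment> \<open>a common upper bound of the ratios below which some triangle could still reach up to \<open>z\<close>\<close>
  define C where "C = sum c {..<n}"
  have "0 \<le> c k" if "k < n" for k
    using side_pos[OF that] left_of_sides[OF that z] by (simp add: c_def)
  then have cC: "c k \<le> C" if "k < n" for k
    using that unfolding C_def by (intro member_le_sum) auto
  have one_sided: "(\<forall>k<n. 0 < ray_offset k x z) \<or> (\<forall>k<n. ray_offset k x z < 0)"
    if "x \<in> start_dirs" "C < closing_ratio x" for x
    using flat_triangles_one_sided[OF that(1) z] cC that(2) by (fastforce simp: c_def)
  have lim: "((\<lambda>x. left_offset x (A 0) z) \<longlongrightarrow> left_offset t (A 0) z) (at t within S)" for t S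
    unfolding left_offset_eq by (intro tendsto_intros)
  show "\<exists>x\<in>start_dirs. \<exists>z\<in>D. \<forall>k<n. 0 < ray_offset k x z"
  proof -
    have "\<forall>\<^sub>F x in at_right (\<tau> 0). 0 < left_offset x (A 0) z"
      using order_tendstoD(1)[OF lim] left_of_sides[OF n_pos z] by blast
    moreover have "\<forall>\<^sub>F x in at_right (\<tau> 0). x \<in> start_dirs"
      unfolding start_dirs_def using start_dirs_nonempty by (intro eventually_at_right_real)
    ultimately have "\<forall>\<^sub>F x in at_right (\<tau> 0). x \<in> start_dirs \<and> C < closing_ratio x \<and> 0 < left_offset x (A 0) z"
      using closing_large_left[of C] by eventually_elim simp
    then obtain x where "x \<in> start_dirs" "C < closing_ratio x" "0 < left_offset x (A 0) z"
      using eventually_happens trivial_limit_at_right_real by blast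
    then show ?thesis
      using one_sided[of x] z n_pos by (force simp: ray_offset_def ray_dir_0)
  qed
  show "\<exists>x\<in>start_dirs. \<exists>z\<in>D. \<forall>k<n. ray_offset k x z < 0"
  proof -
    let ?m = "n - 1"
    have m: "?m < n" "Suc ?m mod n = 0"
      using n_pos by auto
    have "cis b = cis (\<tau> ?m + pi)"
      using cis_total_turn by (simp add: b_def cis_divide[symmetric])
    then have "left_offset b (A 0) z = left_offset (\<tau> ?m + pi) (A 0) z"
      by (simp only: left_offset_cong_cis[of b "\<tau> ?m + pi"])
    also have "\<dots> = - left_offset (\<tau> ?m) (A ?m) z"
      using side[OF m(1)] m(2) by (simp add: left_offset_eq algebra_simps)
    also have "\<dots> < 0"
      using left_of_sides[OF m(1) z] by simp
    finally have "\<forall>\<^sub>F x in at_left b. left_offset x (A 0) z < 0"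
      using order_tendstoD(2)[OF lim] by blast
    moreover have "\<forall>\<^sub>F x in at_left b. x \<in> start_dirs"
      unfolding start_dirs_def b_def using start_dirs_nonempty by (intro eventually_at_left_real)
    ultimately have "\<forall>\<^sub>F x in at_left b. x \<in> start_dirs \<and> C < closing_ratio x \<and> left_offset x (A 0) z < 0"
      using closing_large_right[of C] unfolding b_def[symmetric] by eventually_elim simp
    then obtain x where "x \<in> start_dirs" "C < closing_ratio x" "left_offset x (A 0) z < 0"
      using eventually_happens trivial_limit_at_left_real by blast
    then show ?thesis
      using one_sided[of x] z n_pos by (force simp: ray_offset_def ray_dir_0)
  qed
qed

text \<open>The two kinds of systems with uncovered points form disjoint nonempty open subsets of an interval, so
  they do not exhaust it.\<close>
lemma covering_system:
  "\<exists>P. proportional_system n A D P \<and> D \<subseteq> (\<Union>k<n. closure (base_triangle n A P k))"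
proof -
  let ?L = "{x \<in> start_dirs. \<exists>z\<in>D. \<forall>k<n. 0 < ray_offset k x z}"
  let ?R = "{x \<in> start_dirs. \<exists>z\<in>D. \<forall>k<n. ray_offset k x z < 0}"
  have "connected start_dirs"
    by (simp add: start_dirs_def)
  moreover have "?L \<inter> ?R \<inter> start_dirs = {}"
    using not_left_and_right by blast
  moreover have "?L \<inter> start_dirs \<noteq> {}" "?R \<inter> start_dirs \<noteq> {}"
    using one_sided_exists by blast+
  ultimately have "\<not> start_dirs \<subseteq> ?L \<union> ?R"
    using connectedD[of start_dirs ?L ?R] open_one_sided by blast
  then obtain x where x: "x \<in> start_dirs" "x \<notin> ?L" "x \<notin> ?R"
    by blast
  then have "D \<subseteq> (\<Union>k<n. closure (base_triangle n A (apexes x) k))"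
    using uncovered_one_sided[OF x(1)] by blast
  then show ?thesis
    using proportional[OF x(1)] by blast
qed

end

section \<open>Angles and sides of a convex polygon\<close>

lemma linepath_mem_polygonal_path:
  assumes "k < n" "0 \<le> s" "s < 1"
  shows "linepath (A k) (A (Suc k mod n)) s \<in> path_image (closed_polygonal_path n A)"
proof -
  define t where "t = (real k + s) / n"
  have nt: "real n * t = real k + s"
    using assms by (simp add: t_def)
  have fl: "\<lfloor>real k + s\<rfloor> = int k"
    using assms by linarith
  then have "nat \<lfloor>real n * t\<rfloor> = k" "frac (real n * t) = s"
    by (simp_all add: nt frac_def)
  then have "closed_polygonal_path n A t = linepath (A k) (A (Suc k mod n)) s"
    using assms by (simp add: closed_polygonal_path_def)
  moreover have "t \<in> {0..1}"
  proof -
    have "real k + s \<le> real n"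
      using assms by linarith
    then show ?thesis
      using assms by (simp add: t_def divide_le_eq)
  qed
  ultimately show ?thesis
    unfolding path_image_def by (metis imageI)
qed

lemma closed_polygonal_path_closed:
  assumes "0 < n"
  shows "pathfinish (closed_polygonal_path n A) = pathstart (closed_polygonal_path n A)"
  using assms by (simp add: pathfinish_def pathstart_def closed_polygonal_path_def linepath_0' frac_def)

lemma Im_cnj_mult_eq_0_imp_collinear:
  fixes a b c :: complex
  assumes "Im (cnj (b - a) * (c - a)) = 0"
  shows "collinear {a, b, c}"
proof -
  have "(c - a) / (b - a) \<in> \<real>"
    unfolding complex_is_Real_iff Im_complex_div_eq_0 using assms
    by (subst mult.commute)
  then have "collinear {0, b - a, c - a}"
    by (simp add: collinear_iff_Reals)
  then show ?thesis
    using collinear_3[of b a c] by (simp add: insert_commute)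
qed

lemma left_turn_angle:
  fixes u v :: complex
  assumes "0 < Im (cnj u * v)" and "u = cmod u *\<^sub>R cis t"
  shows "0 < Arg (v / u)" "Arg (v / u) < pi" "v = cmod v *\<^sub>R cis (t + Arg (v / u))"
proof -
  have u0: "u \<noteq> 0" and v0: "v \<noteq> 0"
    using assms(1) by auto
  have "0 < Im (v / u)"
    unfolding Im_complex_div_gt_0 using assms(1) by (subst mult.commute)
  then show "0 < Arg (v / u)" "Arg (v / u) < pi"
    using Arg_lt_pi by auto
  have "cis (Arg (v / u)) = sgn (v / u)"
    using u0 v0 by (intro cis_Arg) simp
  then have q: "v / u = (cmod v / cmod u) *\<^sub>R cis (Arg (v / u))"
    using u0 v0 by (simp add: sgn_div_norm norm_divide)
  have "v = u * (v / u)"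
    using u0 by simp
  also have "\<dots> = (cmod u *\<^sub>R cis t) * ((cmod v / cmod u) *\<^sub>R cis (Arg (v / u)))"
    using assms(2) q by metis
  also have "\<dots> = cmod v *\<^sub>R cis (t + Arg (v / u))"
    using u0 by (simp add: cis_mult)
  finally show "v = cmod v *\<^sub>R cis (t + Arg (v / u))" .
qed

lemma side_angles_exist:
  fixes e :: "nat \<Rightarrow> complex"
  assumes "\<And>k. k < n \<Longrightarrow> 0 < Im (cnj (e k) * e (Suc k))"
  obtains \<tau> :: "nat \<Rightarrow> real" where
    "\<And>k. k \<le> n \<Longrightarrow> e k = cmod (e k) *\<^sub>R cis (\<tau> k)"
    "\<And>k. k < n \<Longrightarrow> \<tau> k < \<tau> (Suc k)"
    "\<And>k. k < n \<Longrightarrow> \<tau> (Suc k) < \<tau> k + pi"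
proof
  define \<tau> where "\<tau> = rec_nat (Arg (e 0)) (\<lambda>k t. t + Arg (e (Suc k) / e k))"
  have \<tau>: "\<tau> 0 = Arg (e 0)" "\<tau> (Suc k) = \<tau> k + Arg (e (Suc k) / e k)" for k
    by (simp_all add: \<tau>_def)
  show polar: "e k = cmod (e k) *\<^sub>R cis (\<tau> k)" if "k \<le> n" for k
    using that
  proof (induction k)
    case 0
    then show ?case
      using rcis_cmod_Arg[of "e 0"] by (simp add: \<tau> rcis_def scaleR_conv_of_real)
  next
    case (Suc k)
    then show ?case
      using left_turn_angle(3)[OF assms, of k] by (simp add: \<tau>)
  qed
  show "\<tau> k < \<tau> (Suc k)" "\<tau> (Suc k) < \<tau> k + pi" if "k < n" for k
    using left_turn_angle(1,2)[OF assms[OF that] polar] that by (simp_all add: \<tau>)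
qed

text \<open>Angles of equal directions differ by a multiple of a full turn. For the sides of a polygon this bounds
  the total turn from below without determining how often the boundary winds around.\<close>
lemma cis_eq_imp_full_turn:
  assumes "cis s = cis t" "s < t"
  shows "s + 2 * pi \<le> t"
proof -
  have "sin t = sin s \<and> cos t = cos s"
    using assms(1) by (simp add: complex_eq_iff)
  then obtain m :: int where m: "t = s + 2 * pi * m"
    using sin_cos_eq_iff by blast
  then have "0 < m"
    using assms(2) by (simp add: zero_less_mult_iff)
  then have "2 * pi * 1 \<le> 2 * pi * m"
    by (intro mult_left_mono) auto
  then show ?thesis
    using m by simp
qed

lemma convex_ngon_closure:
  assumes "is_convex_ngon n A D" "k < n" "0 \<le> s" "s < 1"
  shows "linepath (A k) (A (Suc k mod n)) s \<in> closure D"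
proof -
  let ?\<gamma> = "closed_polygonal_path n A"
  have "simple_path ?\<gamma>" "D = inside (path_image ?\<gamma>)" "0 < n"
    using assms by (auto simp: is_convex_ngon_def is_ngon_def)
  then have "frontier D = path_image ?\<gamma>"
    using Jordan_inside_outside closed_polygonal_path_closed by blast
  then show ?thesis
    using linepath_mem_polygonal_path[OF assms(2-4), of A] by (auto simp: frontier_def)
qed

text \<open>
  By the Jordan curve theorem all vertices lie in the closure of \<open>D\<close>, hence weakly to the left of each
  side; as consecutive sides are not parallel, the next vertex lies strictly to the left.
\<close>
lemma convex_ngon_left_turn:
  assumes ngon: "is_convex_ngon n A D" and k: "k < n"
  shows "0 < Im (cnj (A (Suc k mod n) - A k) * (A (Suc (Suc k) mod n) - A (Suc k mod n)))"
proof -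
  let ?b = "A (Suc k mod n)" and ?c = "A (Suc (Suc k) mod n)"
  have n: "3 \<le> n" and nc: "\<not> collinear {A k, ?b, ?c}"
    and left: "\<forall>z\<in>D. 0 < Im (cnj (?b - A k) * (z - A k))"
    using assms by (auto simp: is_convex_ngon_def is_ngon_def positively_enumerated_def)
  have "?c \<in> closure D"
    using convex_ngon_closure[OF ngon, of "Suc (Suc k) mod n" 0] n by (simp add: linepath_0' frac_def)
  moreover have "closure D \<subseteq> {z. 0 \<le> Im (cnj (?b - A k) * (z - A k))}"
    using left by (intro closure_minimal closed_Collect_le continuous_intros) auto
  ultimately have "0 \<le> Im (cnj (?b - A k) * (?c - A k))"
    by blast
  moreover have "Im (cnj (?b - A k) * (?c - A k)) \<noteq> 0"
    using nc Im_cnj_mult_eq_0_imp_collinear by blast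
  moreover have "Im (cnj (?b - A k) * (?c - A k)) = Im (cnj (?b - A k) * (?c - ?b))"
    by (simp add: algebra_simps)
  ultimately show ?thesis
    by simp
qed

text \<open>
  The side vectors are indexed by all natural numbers, modulo \<open>n\<close> in the vertices, so that the lift of
  their directions reaches index \<open>n\<close>, where the first side comes again.
\<close>
lemma convex_ngon_convex_polygon:
  assumes ngon: "is_convex_ngon n A D"
  obtains \<tau> l where "convex_polygon n \<tau> l A D"
proof -
  have n: "3 \<le> n"
    using ngon by (simp add: is_convex_ngon_def is_ngon_def)
  define e where "e k = A (Suc k mod n) - A (k mod n)" for k
  have turn: "0 < Im (cnj (e k) * e (Suc k))" if "k < n" for k
    using convex_ngon_left_turn[OF ngon that] that by (simp add: e_def)
  then obtain \<tau> where polar: "\<And>k. k \<le> n \<Longrightarrow> e k = cmod (e k) *\<^sub>R cis (\<tau> k)"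
    and gap: "\<And>k. k < n \<Longrightarrow> \<tau> k < \<tau> (Suc k)" "\<And>k. k < n \<Longrightarrow> \<tau> (Suc k) < \<tau> k + pi"
    using side_angles_exist[of n e] by metis
  have e0: "e k \<noteq> 0" if "k < n" for k
    using turn[OF that] by auto
  have "e n = e 0"
    using n by (simp add: e_def mod_Suc)
  then have "cmod (e 0) *\<^sub>R cis (\<tau> n) = cmod (e 0) *\<^sub>R cis (\<tau> 0)"
    using polar[of n] polar[of 0] by simp
  then have cis: "cis (\<tau> n) = cis (\<tau> 0)"
    using e0[of 0] n by simp
  have "\<tau> 0 < \<tau> k" if "0 < k" "k \<le> n" for k
    using that
  proof (induction k)
    case (Suc k)
    then show ?case
      using gap(1)[of k] by (cases "k = 0") auto
  qed simp
  then have total_turn: "\<tau> 0 + 2 * pi \<le> \<tau> n"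
    using cis_eq_imp_full_turn[of "\<tau> 0" "\<tau> n"] cis n by simp
  have ek: "A (Suc k mod n) - A k = cmod (e k) *\<^sub>R cis (\<tau> k)" if "k < n" for k
    using polar[of k] that by (simp add: e_def)
  have "convex_polygon n \<tau> (\<lambda>k. cmod (e k)) A D"
  proof unfold_locales
    fix k z assume k: "k < n" and z: "z \<in> D"
    have "0 < Im (cnj (A (Suc k mod n) - A k) * (z - A k))"
      using ngon k z unfolding is_convex_ngon_def positively_enumerated_def by blast
    also have "\<dots> = Im (cnj (cmod (e k) *\<^sub>R cis (\<tau> k)) * (z - A k))"
      by (simp only: ek[OF k])
    also have "\<dots> = cmod (e k) * left_offset (\<tau> k) (A k) z"
      by (simp add: left_offset_eq algebra_simps)
    finally show "0 < left_offset (\<tau> k) (A k) z"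
      by (simp add: zero_less_mult_iff)
  next
    fix k assume k: "k < n"
    show "A (Suc k mod n) = A k + cmod (e k) *\<^sub>R cis (\<tau> k)"
      using ek[OF k] by (simp add: algebra_simps)
    show "midpoint (A k) (A (Suc k mod n)) \<in> closure D"
      using convex_ngon_closure[OF ngon k, of "1/2"]
      by (simp add: linepath_def midpoint_def scaleR_add_right)
  next
    show "D \<noteq> {}"
      using convex_ngon_closure[OF ngon, of 0 0] n by auto
  qed (use n gap total_turn cis e0 in auto)
  then show ?thesis
    using that by blast
qed

theorem theorem2:
  fixes n :: nat and A :: "nat \<Rightarrow> complex" and D :: "complex set"
  assumes "is_convex_ngon n A D"
  shows "\<exists>P :: nat \<Rightarrow> complex.
           proportional_system n A D P \<and> D \<subseteq> (\<Union>k<n. closure (base_triangle n A P k))"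
proof -
  obtain \<tau> l where "convex_polygon n \<tau> l A D"
    using convex_ngon_convex_polygon[OF assms] by blast
  then show ?thesis
    by (rule convex_polygon.covering_system)
qed

end
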